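(* Let $d\ge1$ and let $\beta$ be a Pisot number of degree $d+1$. Then: (1) The collection $\{\mathcal{S}_\beta(x)\mid x\in\mathbb{Z}[\beta]\cap[0,1)\}$ forms a weak $m$-tiling of $\mathbb{R}^d$ for some $m\ge1$. (2) If $\beta$ satisfies the finiteness property (F), then $\{\mathcal{S}_\beta(x)\mid x\in\mathbb{Z}[\beta]\cap[0,1)\}$ forms a weak tiling of $\mathbb{R}^d$.
   Context: A Pisot number is an algebraic integer $\beta>1$ all of whose other Galois conjugates have modulus $<1$. $T_\beta:[0,1)\to[0,1)$, $T_\beta(x)=\beta x-\lfloor\beta x\rfloor$, and $T_\beta^{-n}(x)=\{y\in[0,1)\mid T_\beta^n(y)=x\}$. $\beta$ has the finiteness property (F) if for every $x\in\mathbb{Z}[\beta^{-1}]\cap[0,1)$ there is $n\in\mathbb{N}$ with $T_\beta^n(x)=0$. Let $\beta_1,\ldots,\beta_d$, $d=p+2s$, be the Galois conjugates of $\beta$ other than $\beta$, with $\beta_1,\ldots,\beta_p$ real, $\beta_{p+1},\ldots,\beta_{p+2s}$ non-real and $\beta_{p+j}=\overline{\beta_{p+s+j}}$ for $1\le j\le s$. For $x\in\mathbb{Q}(\beta)$ let $x^{(j)}$ be the image of $x$ under the field isomorphism $\mathbb{Q}(\beta)\to\mathbb{Q}(\beta_j)$, $\beta\mapsto\beta_j$, and $\Phi_\beta(x)=\big(x^{(1)},\ldots,x^{(p)},\Re x^{(p+1)},\Im x^{(p+1)},\ldots,\Re x^{(p+s)},\Im x^{(p+s)}\big)^t\in\mathbb{R}^d$.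 For $x\in\mathbb{Z}[\beta]\cap[0,1)$ the integral $\beta$-tile is $\mathcal{S}_\beta(x)=\mathrm{Li}_{n\to\infty}\Phi_\beta\big(\beta^n(T_\beta^{-n}(x)\cap\mathbb{Z}[\beta])\big)$, where the lower Hausdorff limit $\mathrm{Li}_{n\to\infty}A_n$ is the set of all $\mathbf{t}\in\mathbb{R}^d$ such that each neighbourhood of $\mathbf{t}$ intersects $A_n$ for all sufficiently large $n$. For a locally finite family $\mathcal{K}=(K_i)_{i\in I}$ of compact sets covering $\mathbb{R}^d$ (locally finite: every open ball meets only finitely many members; here $I=\mathbb{Z}[\beta]\cap[0,1)$) let $\deg(\mathcal{K},\mathbf{t})=\#\{i\in I\mid\mathbf{t}\in K_i\}$ and $\deg(\mathcal{K})=\min_{\mathbf{t}\in\mathbb{R}^d}\deg(\mathcal{K},\mathbf{t})$. $\mathcal{K}$ is a weak $m$-tiling if $\deg(\mathcal{K})=m$ and $\bigcap_{k=1}^{m+1}\mathrm{int}(K_{i_k})=\emptyset$ for all pairwise different $i_1,\ldots,i_{m+1}\in I$. A weak tiling is a weak $1$-tiling. *)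

theory Defs
  imports "HOL-Analysis.Analysis" "HOL-Computational_Algebra.Computational_Algebra"
begin

section \<open>Algebraic numbers and their conjugates\<close>

definition min_poly :: "real \<Rightarrow> rat poly" where
  "min_poly \<beta> = (THE q. lead_coeff q = 1 \<and> irreducible q \<and> poly (map_poly of_rat q) \<beta> = 0)"

text \<open>All complex conjugates, including \<open>\<beta>\<close> itself.\<close>

definition galois_conjugates :: "real \<Rightarrow> complex set" where
  "galois_conjugates \<beta> = {z. poly (map_poly of_rat (min_poly \<beta>)) z = 0}"

definition pisot :: "real \<Rightarrow> bool" where
  "pisot \<beta> \<longleftrightarrow> algebraic_int \<beta> \<and> \<beta> > 1 \<and>
     (\<forall>z \<in> galois_conjugates \<beta> - {of_real \<beta>}. cmod z < 1)"

definition int_adjoin :: "real \<Rightarrow> real set" where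
  "int_adjoin a = range (\<lambda>q :: int poly. poly (map_poly of_int q) a)"

definition is_subfield :: "complex set \<Rightarrow> bool" where
  "is_subfield K \<longleftrightarrow> 1 \<in> K \<and>
     (\<forall>x\<in>K. \<forall>y\<in>K. x - y \<in> K \<and> x * y \<in> K) \<and> (\<forall>x\<in>K. inverse x \<in> K)"

text \<open>A subfield of the complex numbers contains the rationals, so the smallest subfield
  containing \<open>c\<close> is \<open>\<rat>(c)\<close>.\<close>

definition rat_adjoin :: "complex \<Rightarrow> complex set" where
  "rat_adjoin c = \<Inter>{K. is_subfield K \<and> c \<in> K}"

definition field_iso :: "complex set \<Rightarrow> complex set \<Rightarrow> (complex \<Rightarrow> complex) \<Rightarrow> bool" where
  "field_iso K L \<sigma> \<longleftrightarrow> bij_betw \<sigma> K L \<and>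
     (\<forall>x\<in>K. \<forall>y\<in>K. \<sigma> (x + y) = \<sigma> x + \<sigma> y \<and> \<sigma> (x * y) = \<sigma> x * \<sigma> y)"

text \<open>The isomorphism \<open>\<rat>(\<beta>) \<rightarrow> \<rat>(\<gamma>)\<close> with \<open>\<beta> \<mapsto> \<gamma>\<close>; extensionality fixes its values outside
  \<open>\<rat>(\<beta>)\<close>, so that it is unique as a total function.\<close>

definition conj_iso :: "real \<Rightarrow> complex \<Rightarrow> complex \<Rightarrow> complex" where
  "conj_iso \<beta> \<gamma> = (THE \<sigma>. \<sigma> \<in> extensional (rat_adjoin (of_real \<beta>)) \<and>
     field_iso (rat_adjoin (of_real \<beta>)) (rat_adjoin \<gamma>) \<sigma> \<and> \<sigma> (of_real \<beta>) = \<gamma>)"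

definition conjugate_enumeration :: "real \<Rightarrow> nat \<Rightarrow> nat \<Rightarrow> (nat \<Rightarrow> complex) \<Rightarrow> bool" where
  "conjugate_enumeration \<beta> p s b \<longleftrightarrow>
     bij_betw b {1..p + 2 * s} (galois_conjugates \<beta> - {of_real \<beta>}) \<and>
     (\<forall>j\<in>{1..p}. b j \<in> \<real>) \<and>
     (\<forall>j\<in>{p + 1..p + 2 * s}. b j \<notin> \<real>) \<and>
     (\<forall>j\<in>{1..s}. b (p + j) = cnj (b (p + s + j)))"

section \<open>Beta-transformation\<close>

definition beta_map :: "real \<Rightarrow> real \<Rightarrow> real" where
  "beta_map \<beta> x = \<beta> * x - of_int \<lfloor>\<beta> * x\<rfloor>"

definition beta_preimage :: "real \<Rightarrow> nat \<Rightarrow> real \<Rightarrow> real set" where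
  "beta_preimage \<beta> n x = {y \<in> {0..<1}. (beta_map \<beta> ^^ n) y = x}"

definition finiteness_property :: "real \<Rightarrow> bool" where
  "finiteness_property \<beta> \<longleftrightarrow>
     (\<forall>x \<in> int_adjoin (inverse \<beta>) \<inter> {0..<1}. \<exists>n. (beta_map \<beta> ^^ n) x = 0)"

section \<open>Integral beta-tiles\<close>

definition Phi_list :: "real \<Rightarrow> nat \<Rightarrow> nat \<Rightarrow> (nat \<Rightarrow> complex) \<Rightarrow> real \<Rightarrow> real list" where
  "Phi_list \<beta> p s b x =
     map (\<lambda>j. Re (conj_iso \<beta> (b j) (of_real x))) [1..<p + 1] @
     concat (map (\<lambda>j. [Re (conj_iso \<beta> (b j) (of_real x)), Im (conj_iso \<beta> (b j) (of_real x))])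
       [p + 1..<p + s + 1])"

text \<open>\<open>\<real>\<^sup>d\<close> is \<open>real ^ 'n\<close> with \<open>CARD('n) = d\<close>; the linear order on the index type identifies it
  with \<open>{0..<d}\<close>.\<close>

definition Phi :: "real \<Rightarrow> nat \<Rightarrow> nat \<Rightarrow> (nat \<Rightarrow> complex) \<Rightarrow> real \<Rightarrow> real ^ 'n::{finite,linorder}" where
  "Phi \<beta> p s b x = (\<chi> i. Phi_list \<beta> p s b x ! card {j. j < i})"

definition lower_hausdorff_limit :: "(nat \<Rightarrow> 'a::topological_space set) \<Rightarrow> 'a set" where
  "lower_hausdorff_limit A =
     {t. \<forall>U. open U \<and> t \<in> U \<longrightarrow> (\<forall>\<^sub>F n in sequentially. U \<inter> A n \<noteq> {})}"

definition integral_beta_tile ::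
    "real \<Rightarrow> nat \<Rightarrow> nat \<Rightarrow> (nat \<Rightarrow> complex) \<Rightarrow> real \<Rightarrow> (real ^ 'n::{finite,linorder}) set" where
  "integral_beta_tile \<beta> p s b x = lower_hausdorff_limit
     (\<lambda>n. (\<lambda>y. Phi \<beta> p s b (\<beta> ^ n * y)) ` (beta_preimage \<beta> n x \<inter> int_adjoin \<beta>))"

section \<open>Weak tilings\<close>

text \<open>Families are indexed: equal tiles with different indices are counted separately.\<close>

definition locally_finite_family :: "'i set \<Rightarrow> ('i \<Rightarrow> 'a::metric_space set) \<Rightarrow> bool" where
  "locally_finite_family I K \<longleftrightarrow> (\<forall>c r. finite {i \<in> I. K i \<inter> ball c r \<noteq> {}})"

definition degree_at :: "'i set \<Rightarrow> ('i \<Rightarrow> 'a set) \<Rightarrow> 'a \<Rightarrow> nat" where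
  "degree_at I K t = card {i \<in> I. t \<in> K i}"

text \<open>The infimum of a nonempty set of naturals is attained, so this is the minimum; the cardinalities
  are those of finite sets when the family is locally finite.\<close>

definition covering_degree :: "'i set \<Rightarrow> ('i \<Rightarrow> 'a set) \<Rightarrow> nat" where
  "covering_degree I K = (INF t. degree_at I K t)"

definition weak_m_tiling :: "nat \<Rightarrow> 'i set \<Rightarrow> ('i \<Rightarrow> 'a::metric_space set) \<Rightarrow> bool" where
  "weak_m_tiling m I K \<longleftrightarrow>
     locally_finite_family I K \<and> (\<forall>i\<in>I. compact (K i)) \<and> (\<Union>i\<in>I. K i) = UNIV \<and>
     covering_degree I K = m \<and>
     (\<forall>J \<subseteq> I. card J = m + 1 \<longrightarrow> (\<Inter>i\<in>J. interior (K i)) = {})"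

abbreviation weak_tiling :: "'i set \<Rightarrow> ('i \<Rightarrow> 'a::metric_space set) \<Rightarrow> bool" where
  "weak_tiling \<equiv> weak_m_tiling 1"

end

theory Submission
  imports Defs "HOL-Computational_Algebra.Field_as_Ring"
begin

text \<open>
  Let \<open>M\<close> be the contraction of \<open>\<real>\<^sup>d\<close> with \<open>\<Phi> (\<beta> x) = M (\<Phi> x)\<close>, and let \<open>T\<close> be the
  beta-transformation on \<open>X = \<int>[\<beta>] \<inter> [0, 1)\<close>. The norm of \<open>\<beta>\<close> is smaller than \<open>\<beta>\<close>, hence \<open>T\<close>
  maps \<open>X\<close> onto itself, and the approximations of the tile of \<open>x\<close> converge geometrically. Since
  the tile of \<open>x\<close> is the union of the sets \<open>M (S x')\<close> with \<open>T x' = x\<close>, the covering degree at \<open>t\<close>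
  is at least the one at \<open>M t\<close>. If \<open>n\<close> is large and \<open>z \<in> \<beta>\<^sup>n \<int>[\<beta>]\<close> is small and nonnegative, then
  the degree at \<open>t\<^sub>0 + \<Phi> z\<close> does not exceed the one at \<open>t\<^sub>0\<close>; the points \<open>\<Phi> z\<close> are relatively
  dense, so the minimal degree \<open>m\<close> is attained in every large ball. An open set in which the degree
  exceeds \<open>m\<close> would be blown up by the inverse of \<open>M\<close> to a large ball with the same property.

  Under (F), the set of those \<open>x\<close> whose tile contains \<open>0\<close> is finite, and every element \<open>x\<close> of it is
  of the form \<open>T\<^sup>n x'\<close> with \<open>x'\<close> in the same set and \<open>n\<close> arbitrary. For large \<open>n\<close> this gives
  \<open>x = 0\<close>, so the degree at \<open>0\<close> is \<open>1\<close>.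
\<close>

section \<open>Tiles generated by an onto beta-transformation on a lattice\<close>

text \<open>An open neighbourhood of a point of the closure is also a neighbourhood of some point of
  the limit itself.\<close>

lemma closed_lower_hausdorff_limit: "closed (lower_hausdorff_limit A)"
proof -
  have "closure (lower_hausdorff_limit A) \<subseteq> lower_hausdorff_limit A"
  proof
    fix t assume t: "t \<in> closure (lower_hausdorff_limit A)"
    show "t \<in> lower_hausdorff_limit A"
      unfolding lower_hausdorff_limit_def
    proof (intro CollectI allI impI, elim conjE)
      fix U assume U: "open U" "t \<in> U"
      with t obtain s where "s \<in> lower_hausdorff_limit A" "s \<in> U"
        by (metis IntE closure_iff_nhds_not_empty disjoint_iff subset_refl)
      with U show "\<forall>\<^sub>F n in sequentially. U \<inter> A n \<noteq> {}"
        by (auto simp: lower_hausdorff_limit_def)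
    qed
  qed
  then show ?thesis by (simp add: closure_subset_eq)
qed

text \<open>Stands in for compactness: when the approximants at all levels have their indices in a
  finite set, one index serves infinitely many levels, as \<open>tileI\<close> requires.\<close>

lemma infinite_nat_pigeonhole:
  fixes f :: "nat \<Rightarrow> 'a"
  assumes "finite F" "\<And>n. f n \<in> F"
  obtains x where "x \<in> F" "infinite {n. f n = x}"
proof -
  have "finite (f ` UNIV)" using assms by (meson finite_subset image_subsetI)
  from pigeonhole_infinite[OF infinite_UNIV_nat this] obtain a where "infinite {n. f n = f a}"
    by auto
  with assms(2) that show ?thesis by blast
qed

lemma beta_map_in_unit: "beta_map \<beta> x \<in> {0..<1}"
  unfolding beta_map_def using frac_lt_1[of "\<beta> * x"] frac_ge_0[of "\<beta> * x"]
  by (simp add: frac_def)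

text \<open>The map \<open>(\<Phi>, id)\<close> embeds \<open>Z\<close> as a lattice in \<open>'v \<times> \<real>\<close>; this is what
  \<open>lattice_discrete\<close> and \<open>lattice_dense\<close> express.\<close>

lemma norm_diff_triangle_ineq3:
  fixes x y z :: "'a::real_normed_vector"
  shows "norm (x - z) \<le> norm (x - y) + norm (y - z)"
  using norm_triangle_ineq[of "x - y" "y - z"] by simp

locale beta_lattice =
  fixes \<beta> :: real and Z :: "real set" and \<Phi> :: "real \<Rightarrow> 'v::euclidean_space"
    and M :: "'v \<Rightarrow> 'v" and \<rho> c :: real
  assumes beta_gt_1: "\<beta> > 1"
    and of_int_in: "of_int k \<in> Z"
    and add_in: "x \<in> Z \<Longrightarrow> y \<in> Z \<Longrightarrow> x + y \<in> Z"
    and mult_in: "x \<in> Z \<Longrightarrow> y \<in> Z \<Longrightarrow> x * y \<in> Z"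
    and beta_in: "\<beta> \<in> Z"
    and Phi_add: "x \<in> Z \<Longrightarrow> y \<in> Z \<Longrightarrow> \<Phi> (x + y) = \<Phi> x + \<Phi> y"
    and Phi_of_int_mult: "x \<in> Z \<Longrightarrow> \<Phi> (of_int k * x) = of_int k *\<^sub>R \<Phi> x"
    and Phi_beta: "x \<in> Z \<Longrightarrow> \<Phi> (\<beta> * x) = M (\<Phi> x)"
    and linear_M: "linear M" and surj_M: "surj M"
    and rho: "0 < \<rho>" "\<rho> < 1" and norm_M: "norm (M v) \<le> \<rho> * norm v"
    and c_pos: "c > 0" and norm_M_ge: "norm v \<le> c * norm (M v)"
    and lattice_discrete: "finite {x \<in> Z. \<bar>x\<bar> \<le> C \<and> norm (\<Phi> x) \<le> C}"
    and lattice_dense: "\<exists>R. \<forall>t. \<exists>x\<in>Z. \<bar>x\<bar> \<le> R \<and> norm (\<Phi> x - t) \<le> R"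
    and arbitrarily_small: "\<epsilon> > 0 \<Longrightarrow> \<exists>u\<in>Z. 0 < u \<and> u < \<epsilon>"
    and beta_map_onto: "x \<in> Z \<inter> {0..<1} \<Longrightarrow> \<exists>y\<in>Z \<inter> {0..<1}. beta_map \<beta> y = x"
begin

abbreviation "X \<equiv> Z \<inter> {0..<1}"
abbreviation "T \<equiv> beta_map \<beta>"

definition P :: "nat \<Rightarrow> real \<Rightarrow> real set" where
  "P n x = {y \<in> X. (T ^^ n) y = x}"

definition S :: "real \<Rightarrow> 'v set" where
  "S x = lower_hausdorff_limit (\<lambda>n. (\<lambda>y. \<Phi> (\<beta> ^ n * y)) ` (beta_preimage \<beta> n x \<inter> Z))"

lemma P_eq: "beta_preimage \<beta> n x \<inter> Z = P n x"
  by (auto simp: P_def beta_preimage_def)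

lemma minus_in: "x \<in> Z \<Longrightarrow> - x \<in> Z"
  using mult_in[of "of_int (-1)" x] of_int_in[of "-1"] by simp

lemma diff_in: "x \<in> Z \<Longrightarrow> y \<in> Z \<Longrightarrow> x - y \<in> Z"
  using add_in[of x "-y"] minus_in by simp

lemma power_in: "\<beta> ^ n \<in> Z"
  by (induction n) (use of_int_in[of 1] in \<open>auto intro: mult_in beta_in\<close>)

lemma Phi_minus: "x \<in> Z \<Longrightarrow> \<Phi> (- x) = - \<Phi> x"
  using Phi_of_int_mult[of x "-1"] by simp

lemma Phi_diff: "x \<in> Z \<Longrightarrow> y \<in> Z \<Longrightarrow> \<Phi> (x - y) = \<Phi> x - \<Phi> y"
  using Phi_add[of x "-y"] by (simp add: minus_in Phi_minus)

lemma Phi_power: "x \<in> Z \<Longrightarrow> \<Phi> (\<beta> ^ n * x) = (M ^^ n) (\<Phi> x)"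
  by (induction n) (simp_all add: mult.assoc Phi_beta power_in mult_in)

lemma linear_M_power: "linear (M ^^ n)"
proof (induction n)
  case (Suc n)
  then have "linear (M \<circ> M ^^ n)" by (rule linear_compose[OF _ linear_M])
  then show ?case by (simp add: comp_def)
qed (simp add: linear_iff)

lemma norm_M_power: "norm ((M ^^ n) v) \<le> \<rho> ^ n * norm v"
proof (induction n)
  case (Suc n)
  have "norm ((M ^^ Suc n) v) \<le> \<rho> * norm ((M ^^ n) v)" using norm_M by simp
  also have "\<dots> \<le> \<rho> * (\<rho> ^ n * norm v)" using Suc rho by simp
  finally show ?case by (simp add: mult.assoc)
qed simp

lemma surj_M_power: "surj (M ^^ n)"
  using surj_M by (simp add: surj_fn)

lemma T_in: "x \<in> X \<Longrightarrow> T x \<in> X"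
  using beta_map_in_unit[of \<beta> x] by (auto simp: beta_map_def intro!: diff_in mult_in beta_in of_int_in)

lemma T_power_in: "x \<in> X \<Longrightarrow> (T ^^ n) x \<in> X"
  by (induction n) (auto simp: T_in simp del: IntI Int_iff)

lemma T_power_onto: "x \<in> X \<Longrightarrow> \<exists>y\<in>X. (T ^^ n) y = x"
proof (induction n arbitrary: x)
  case (Suc n)
  then obtain y where "y \<in> X" "T y = x" using beta_map_onto by blast
  moreover from Suc.IH[OF this(1)] obtain z where "z \<in> X" "(T ^^ n) z = y" by blast
  ultimately show ?case by (intro bexI[of _ z]) auto
qed auto

section \<open>Geometric convergence of the approximations of a tile\<close>

definition E :: real where "E = \<beta> * norm (\<Phi> 1) / (1 - \<rho>)"

lemma E_nonneg: "E \<ge> 0"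
  using beta_gt_1 rho by (auto simp: E_def)

text \<open>\<open>\<beta> * y\<close> and \<open>T y\<close> differ by a digit of size at most
  \<beta>, whose contribution is contracted by \<open>\<rho> ^ n\<close>.\<close>

lemma Phi_T_step:
  assumes "y \<in> X"
  shows "norm (\<Phi> (\<beta> ^ Suc n * y) - \<Phi> (\<beta> ^ n * T y)) \<le> E * (1 - \<rho>) * \<rho> ^ n"
proof -
  define k where "k = \<lfloor>\<beta> * y\<rfloor>"
  have k: "0 \<le> k" "of_int k \<le> \<beta>"
  proof -
    show "0 \<le> k" using assms beta_gt_1 by (auto simp: k_def)
    have "of_int k \<le> \<beta> * y" by (simp add: k_def)
    also have "\<dots> \<le> \<beta> * 1" using assms beta_gt_1 by (intro mult_left_mono) auto
    finally show "of_int k \<le> \<beta>" by simp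
  qed
  have "\<beta> ^ Suc n * y = \<beta> ^ n * T y + \<beta> ^ n * (of_int k * 1)"
    by (simp add: beta_map_def k_def algebra_simps)
  moreover have "T y \<in> Z" using T_in[OF assms] by simp
  ultimately have "\<Phi> (\<beta> ^ Suc n * y) - \<Phi> (\<beta> ^ n * T y) = \<Phi> (\<beta> ^ n * (of_int k * 1))"
    using Phi_add[of "\<beta> ^ n * T y" "\<beta> ^ n * (of_int k * 1)"]
    by (simp add: mult_in power_in of_int_in)
  also have "\<dots> = (M ^^ n) (of_int k *\<^sub>R \<Phi> 1)"
    using Phi_power[of "of_int k * 1" n] Phi_of_int_mult[of 1 k] of_int_in[of 1] of_int_in[of k] by simp
  finally have "norm (\<Phi> (\<beta> ^ Suc n * y) - \<Phi> (\<beta> ^ n * T y)) \<le> \<rho> ^ n * norm (of_int k *\<^sub>R \<Phi> 1)"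
    using norm_M_power by metis
  also have "\<dots> \<le> \<rho> ^ n * (\<beta> * norm (\<Phi> 1))"
    using k rho by (intro mult_left_mono) (auto intro: mult_right_mono)
  finally show ?thesis using rho by (simp add: E_def mult.commute)
qed

text \<open>Telescoping over single applications of \<open>T\<close>; \<open>E\<close> is the sum of
  the geometric series of their errors.\<close>

lemma Phi_T_power:
  assumes "y \<in> X"
  shows "norm (\<Phi> (\<beta> ^ (n + k) * y) - \<Phi> (\<beta> ^ n * (T ^^ k) y)) \<le> E * \<rho> ^ n"
proof -
  \<comment> \<open>The exact partial sum of the series closes the induction; the bound
    \<open>E * \<rho> ^ n\<close> alone would not.\<close>
  have "norm (\<Phi> (\<beta> ^ (n + k) * y) - \<Phi> (\<beta> ^ n * (T ^^ k) y)) \<le> E * (\<rho> ^ n - \<rho> ^ (n + k))"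
    using assms
  proof (induction k arbitrary: y)
    case (Suc k)
    have "norm (\<Phi> (\<beta> ^ (n + Suc k) * y) - \<Phi> (\<beta> ^ n * (T ^^ Suc k) y)) \<le>
      norm (\<Phi> (\<beta> ^ Suc (n + k) * y) - \<Phi> (\<beta> ^ (n + k) * T y)) +
      norm (\<Phi> (\<beta> ^ (n + k) * T y) - \<Phi> (\<beta> ^ n * (T ^^ k) (T y)))"
      unfolding funpow_Suc_right o_apply add_Suc_right by (rule norm_diff_triangle_ineq3)
    also have "\<dots> \<le> E * (1 - \<rho>) * \<rho> ^ (n + k) + E * (\<rho> ^ n - \<rho> ^ (n + k))"
      by (intro add_mono Phi_T_step Suc.IH Suc.prems T_in)
    also have "\<dots> = E * (\<rho> ^ n - \<rho> ^ (n + Suc k))" by (simp add: algebra_simps)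
    finally show ?case .
  qed simp
  also have "\<dots> \<le> E * \<rho> ^ n" using E_nonneg rho by (intro mult_left_mono) auto
  finally show ?thesis .
qed

lemma rho_power_small: "\<delta> > 0 \<Longrightarrow> \<forall>\<^sub>F n in sequentially. K * \<rho> ^ n < \<delta>"
proof -
  assume "\<delta> > 0"
  have "(\<lambda>n. K * \<rho> ^ n) \<longlonglongrightarrow> K * 0"
    using rho by (intro tendsto_mult_left LIMSEQ_power_zero) auto
  with \<open>\<delta> > 0\<close> show ?thesis by (auto dest: order_tendstoD(2))
qed

text \<open>Approximants exist at every level \<open>n\<close>, not only at large ones: a far level
  \<open>n + N0\<close> has one within \<open>\<rho> ^ n\<close>, and applying \<open>T\<close> to
  it \<open>N0\<close> times costs another \<open>E * \<rho> ^ n\<close>.\<close>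

lemma tileD:
  assumes "t \<in> S x"
  obtains y where "y \<in> P n x" "norm (\<Phi> (\<beta> ^ n * y) - t) \<le> (E + 1) * \<rho> ^ n"
proof -
  have "open (ball t (\<rho> ^ n))" "t \<in> ball t (\<rho> ^ n)" using rho by auto
  with assms have "\<forall>\<^sub>F N in sequentially. ball t (\<rho> ^ n) \<inter> (\<lambda>y. \<Phi> (\<beta> ^ N * y)) ` P N x \<noteq> {}"
    unfolding S_def lower_hausdorff_limit_def P_eq by blast
  then obtain N0 where "\<forall>N\<ge>N0. ball t (\<rho> ^ n) \<inter> (\<lambda>y. \<Phi> (\<beta> ^ N * y)) ` P N x \<noteq> {}"
    by (auto simp: eventually_sequentially)
  then have "ball t (\<rho> ^ n) \<inter> (\<lambda>y. \<Phi> (\<beta> ^ (n + N0) * y)) ` P (n + N0) x \<noteq> {}" by auto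
  then obtain y where y: "y \<in> P (n + N0) x" "dist t (\<Phi> (\<beta> ^ (n + N0) * y)) < \<rho> ^ n" by auto
  let ?y' = "(T ^^ N0) y"
  from y(1) have yX: "y \<in> X" and "(T ^^ (n + N0)) y = x" by (auto simp: P_def)
  then have "?y' \<in> P n x" using T_power_in[OF yX, of N0] by (auto simp: P_def funpow_add)
  moreover have "norm (\<Phi> (\<beta> ^ n * ?y') - t) \<le> norm (\<Phi> (\<beta> ^ (n + N0) * y) - t)
      + norm (\<Phi> (\<beta> ^ (n + N0) * y) - \<Phi> (\<beta> ^ n * ?y'))"
    by (metis norm_diff_triangle_ineq3 norm_minus_commute add.commute)
  with Phi_T_power[OF yX, of n N0] y(2) have "norm (\<Phi> (\<beta> ^ n * ?y') - t) \<le> (E + 1) * \<rho> ^ n"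
    by (simp add: dist_norm norm_minus_commute algebra_simps)
  ultimately show ?thesis using that by blast
qed

text \<open>A tile asks for approximants at all large levels, but infinitely many levels suffice: as
  \<open>T\<close> maps \<open>X\<close> onto itself, an approximant at level \<open>n\<close> lifts
  to every level \<open>N \<ge> n\<close>, moving by at most \<open>E * \<rho> ^ n\<close>.\<close>

lemma tileI:
  assumes "infinite {n. \<exists>y\<in>P n x. norm (\<Phi> (\<beta> ^ n * y) - t) \<le> K * \<rho> ^ n}"
  shows "t \<in> S x"
  unfolding S_def lower_hausdorff_limit_def P_eq
proof (intro CollectI allI impI, elim conjE)
  fix U assume "open U" "t \<in> U"
  then obtain \<delta> where \<delta>: "\<delta> > 0" "ball t \<delta> \<subseteq> U" by (meson open_contains_ball)
  from rho_power_small[OF this(1), of "K + E"] obtain n0 where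
    n0: "\<And>n. n \<ge> n0 \<Longrightarrow> (K + E) * \<rho> ^ n < \<delta>" by (auto simp: eventually_sequentially)
  from assms obtain n y where n: "n \<ge> n0" and y: "y \<in> P n x" "norm (\<Phi> (\<beta> ^ n * y) - t) \<le> K * \<rho> ^ n"
    unfolding infinite_nat_iff_unbounded_le by blast
  have "U \<inter> (\<lambda>y. \<Phi> (\<beta> ^ N * y)) ` P N x \<noteq> {}" if "N \<ge> n" for N
  proof -
    from that obtain k where k: "N = n + k" using le_Suc_ex by blast
    from y(1) have "y \<in> X" and Ty: "(T ^^ n) y = x" by (auto simp: P_def)
    from T_power_onto[OF this(1)] obtain y' where y': "y' \<in> X" "(T ^^ k) y' = y" by blast
    have "y' \<in> P N x" using y' Ty by (auto simp: P_def k funpow_add)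
    moreover have "norm (\<Phi> (\<beta> ^ N * y') - t) \<le> norm (\<Phi> (\<beta> ^ N * y') - \<Phi> (\<beta> ^ n * y)) +
        norm (\<Phi> (\<beta> ^ n * y) - t)"
      by (rule norm_diff_triangle_ineq3)
    with Phi_T_power[OF y'(1), of n k] y(2) y'(2) n0[OF n] have "dist t (\<Phi> (\<beta> ^ N * y')) < \<delta>"
      by (simp add: k dist_norm norm_minus_commute algebra_simps)
    then have "\<Phi> (\<beta> ^ N * y') \<in> U" using \<delta>(2) by auto
    ultimately have "\<Phi> (\<beta> ^ N * y') \<in> U \<inter> (\<lambda>y. \<Phi> (\<beta> ^ N * y)) ` P N x"
      by (intro IntI imageI)
    then show ?thesis by (metis empty_iff)
  qed
  then show "\<forall>\<^sub>F N in sequentially. U \<inter> (\<lambda>y. \<Phi> (\<beta> ^ N * y)) ` P N x \<noteq> {}"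
    by (auto simp: eventually_sequentially)
qed

lemma tile_near:
  assumes "t \<in> S x"
  shows "norm (\<Phi> x - t) \<le> E + 1"
  \<comment> \<open>At level 0 the only possible approximant is \<open>x\<close> itself, which gives
    a bound uniform in \<open>x\<close>.\<close>
  using tileD[OF assms, of 0] by (auto simp: P_def)

lemma finite_X_bounded: "finite {x \<in> X. norm (\<Phi> x - t) \<le> K}"
\<comment> \<open>\<open>lattice_discrete\<close> has one constant for both coordinates; the real
  one is below 1 because \<open>x\<close> lies in \<open>X\<close>.\<close>
proof (rule finite_subset[OF _ lattice_discrete[of "max 1 (K + norm t)"]], safe)
  fix x assume "x \<in> {0..<1::real}" "norm (\<Phi> x - t) \<le> K"
  then show "\<bar>x\<bar> \<le> max 1 (K + norm t)" "norm (\<Phi> x) \<le> max 1 (K + norm t)"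
    using norm_triangle_ineq[of "\<Phi> x - t" t] by auto
qed

lemma finite_tiles_at: "finite {x \<in> X. t \<in> S x}"
  by (rule finite_subset[OF _ finite_X_bounded[of t "E + 1"]]) (auto intro: tile_near)

lemma compact_tile: "compact (S x)"
proof -
  have "S x \<subseteq> cball (\<Phi> x) (E + 1)" using tile_near by (auto simp: dist_norm)
  then have "bounded (S x)" using bounded_cball bounded_subset by blast
  moreover have "closed (S x)" unfolding S_def by (rule closed_lower_hausdorff_limit)
  ultimately show ?thesis by (simp add: compact_eq_bounded_closed)
qed

lemma locally_finite_tiles: "locally_finite_family X S"
  unfolding locally_finite_family_def
proof (intro allI)
  fix a r
  show "finite {i \<in> X. S i \<inter> ball a r \<noteq> {}}"
  proof (rule finite_subset[OF _ finite_X_bounded[of a "E + 1 + r"]], safe)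
    fix x t assume "t \<in> S x" "t \<in> ball a r"
    moreover have "norm (\<Phi> x - a) \<le> norm (\<Phi> x - t) + norm (t - a)"
      by (rule norm_diff_triangle_ineq3)
    ultimately show "norm (\<Phi> x - a) \<le> E + 1 + r"
      using tile_near[of t x] by (auto simp: dist_norm norm_minus_commute)
  qed
qed

text \<open>Subtracting a multiple of a small \<open>u\<close> brings a bounded \<open>x\<close>
  into \<open>[0, u)\<close>; the multiplier is bounded, so \<open>\<Phi> x\<close> moves a bounded
  distance. \<open>R\<close> depends on \<epsilon> but not on \<open>t\<close>.\<close>

lemma X_relatively_dense:
  assumes "\<epsilon> > 0"
  obtains R where "\<And>t. \<exists>x\<in>Z. 0 \<le> x \<and> x < \<epsilon> \<and> norm (\<Phi> x - t) \<le> R"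
proof -
  obtain R where R: "\<And>t. \<exists>x\<in>Z. \<bar>x\<bar> \<le> R \<and> norm (\<Phi> x - t) \<le> R" using lattice_dense by blast
  obtain u where u: "u \<in> Z" "0 < u" "u < \<epsilon>" using arbitrarily_small[OF assms] by blast
  have "\<exists>x\<in>Z. 0 \<le> x \<and> x < \<epsilon> \<and> norm (\<Phi> x - t) \<le> R + (R / u + 1) * norm (\<Phi> u)" for t
  proof -
    obtain x where x: "x \<in> Z" "\<bar>x\<bar> \<le> R" "norm (\<Phi> x - t) \<le> R" using R by blast
    define k where "k = \<lfloor>x / u\<rfloor>"
    have k: "of_int k \<le> x / u" "x / u < of_int k + 1" unfolding k_def by linarith+
    have xu: "\<bar>x / u\<bar> \<le> R / u" using x u by (simp add: divide_right_mono)
    have kb: "\<bar>of_int k\<bar> \<le> R / u + 1" using k xu by linarith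
    have 1: "x - of_int k * u \<in> Z" using x u by (intro diff_in mult_in of_int_in)
    have 2: "0 \<le> x - of_int k * u" "x - of_int k * u < \<epsilon>"
      using k u by (simp_all add: field_simps)
    have "\<Phi> (x - of_int k * u) - t = (\<Phi> x - t) - of_int k *\<^sub>R \<Phi> u"
      using x u by (simp add: Phi_diff Phi_of_int_mult mult_in of_int_in)
    then have "norm (\<Phi> (x - of_int k * u) - t) \<le> norm (\<Phi> x - t) + \<bar>of_int k\<bar> * norm (\<Phi> u)"
      using norm_triangle_ineq4[of "\<Phi> x - t" "of_int k *\<^sub>R \<Phi> u"] by (simp only: norm_scaleR real_norm_def)
    also have "\<dots> \<le> R + (R / u + 1) * norm (\<Phi> u)"
      using x kb by (intro add_mono mult_right_mono) auto
    finally show ?thesis using 1 2 by blast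
  qed
  then show ?thesis using that by blast
qed

lemma tiles_cover: "\<exists>x\<in>X. t \<in> S x"
proof -
  obtain R where R: "\<And>t. \<exists>x\<in>Z. 0 \<le> x \<and> x < 1 \<and> norm (\<Phi> x - t) \<le> R"
    using X_relatively_dense[of 1] by auto
  then obtain x\<^sub>0 where "norm (\<Phi> x\<^sub>0 - 0) \<le> R" by blast
  then have R0: "0 \<le> R" by (rule order_trans[OF norm_ge_zero])
  have "\<exists>y\<in>X. norm (\<Phi> (\<beta> ^ n * y) - t) \<le> R * \<rho> ^ n" for n
  proof -
    \<comment> \<open>Approximating a preimage of \<open>t\<close> with error \<open>R\<close> and
      pushing forward by \<open>M ^^ n\<close> leaves the error
      \<open>R * \<rho> ^ n\<close>.\<close>
    obtain t' where t': "(M ^^ n) t' = t" using surj_M_power by (metis surjD)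
    obtain y where y: "y \<in> Z" "0 \<le> y" "y < 1" "norm (\<Phi> y - t') \<le> R" using R by blast
    have "\<Phi> (\<beta> ^ n * y) - t = (M ^^ n) (\<Phi> y - t')"
      using y linear_M_power[of n] t' by (simp add: Phi_power linear_diff)
    then have "norm (\<Phi> (\<beta> ^ n * y) - t) \<le> \<rho> ^ n * norm (\<Phi> y - t')" using norm_M_power by simp
    also have "\<dots> \<le> \<rho> ^ n * R" using y rho by (intro mult_left_mono) auto
    finally show ?thesis using y by (auto simp: mult.commute)
  qed
  then obtain y where y: "\<And>n. y n \<in> X" "\<And>n. norm (\<Phi> (\<beta> ^ n * y n) - t) \<le> R * \<rho> ^ n"
    by metis
  \<comment> \<open>The points \<open>(T ^^ n) (y n)\<close> range over a finite set; one that
    recurs for infinitely many \<open>n\<close> indexes a tile containing \<open>t\<close>.\<close>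
  have "(T ^^ n) (y n) \<in> {x \<in> X. norm (\<Phi> x - t) \<le> E + R}" for n
  proof -
    have "norm (\<Phi> ((T ^^ n) (y n)) - t) \<le>
        norm (\<Phi> (\<beta> ^ n * y n) - t) + norm (\<Phi> (\<beta> ^ n * y n) - \<Phi> ((T ^^ n) (y n)))"
      by (metis norm_diff_triangle_ineq3 norm_minus_commute add.commute)
    also have "\<dots> \<le> R * \<rho> ^ n + E" using y Phi_T_power[of "y n" 0 n] by (intro add_mono) auto
    also have "R * \<rho> ^ n \<le> R * 1"
      using R0 rho by (intro mult_left_mono power_le_one) auto
    finally show ?thesis using T_power_in[OF y(1)] by auto
  qed
  then obtain x where x: "x \<in> {x \<in> X. norm (\<Phi> x - t) \<le> E + R}" "infinite {n. (T ^^ n) (y n) = x}"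
    by (rule infinite_nat_pigeonhole[OF finite_X_bounded])
  have "t \<in> S x"
    by (rule tileI[of _ _ R], rule infinite_super[OF _ x(2)]) (use y in \<open>auto simp: P_def\<close>)
  with x(1) show ?thesis by blast
qed

section \<open>Subdivision of tiles and the degree under \<open>M\<close>\<close>

lemma tile_subdivision:
  assumes "M t \<in> S x"
  obtains x' where "x' \<in> X" "T x' = x" "t \<in> S x'"
proof -
  \<comment> \<open>Undoing \<open>M\<close> in the error \<open>(E + 1) * \<rho> ^ Suc n\<close>
    costs the factor \<open>c\<close> of \<open>norm_M_ge\<close>.\<close>
  let ?K = "c * ((E + 1) * \<rho>)"
  have K: "?K \<ge> 0" using c_pos rho E_nonneg by simp
  \<comment> \<open>An approximant \<open>y\<close> of \<open>M t\<close> at level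
    \<open>n + 1\<close> for \<open>x\<close> also approximates \<open>t\<close> at level
    \<open>n\<close> for \<open>(T ^^ n) y\<close>, which \<open>T\<close> sends to
    \<open>x\<close>.\<close>
  have "\<exists>y\<in>P (Suc n) x. norm (\<Phi> (\<beta> ^ n * y) - t) \<le> ?K * \<rho> ^ n" for n
  proof -
    from assms obtain y where y: "y \<in> P (Suc n) x"
      "norm (\<Phi> (\<beta> ^ Suc n * y) - M t) \<le> (E + 1) * \<rho> ^ Suc n" by (rule tileD)
    then have "y \<in> Z" by (auto simp: P_def)
    then have "\<Phi> (\<beta> ^ Suc n * y) - M t = M (\<Phi> (\<beta> ^ n * y) - t)"
      by (simp add: mult.assoc Phi_beta mult_in power_in linear_diff[OF linear_M])
    with y(2) have "c * norm (M (\<Phi> (\<beta> ^ n * y) - t)) \<le> c * ((E + 1) * \<rho> ^ Suc n)"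
      using c_pos by (intro mult_left_mono) auto
    with norm_M_ge[of "\<Phi> (\<beta> ^ n * y) - t"] have "norm (\<Phi> (\<beta> ^ n * y) - t) \<le> ?K * \<rho> ^ n"
      by (simp add: mult.assoc mult.left_commute)
    with y(1) show ?thesis by blast
  qed
  then obtain y where y: "\<And>n. y n \<in> P (Suc n) x"
    "\<And>n. norm (\<Phi> (\<beta> ^ n * y n) - t) \<le> ?K * \<rho> ^ n" by metis
  then have yX: "y n \<in> X" for n by (auto simp: P_def)
  have "(T ^^ n) (y n) \<in> {x \<in> X. norm (\<Phi> x - t) \<le> E + ?K}" for n
  proof -
    have "norm (\<Phi> ((T ^^ n) (y n)) - t) \<le>
        norm (\<Phi> (\<beta> ^ n * y n) - t) + norm (\<Phi> (\<beta> ^ n * y n) - \<Phi> ((T ^^ n) (y n)))"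
      by (metis norm_diff_triangle_ineq3 norm_minus_commute add.commute)
    also have "\<dots> \<le> ?K * \<rho> ^ n + E" using y Phi_T_power[OF yX, of 0 n] by (intro add_mono) auto
    also have "?K * \<rho> ^ n \<le> ?K * 1"
      using K rho by (intro mult_left_mono power_le_one) auto
    finally show ?thesis using T_power_in[OF yX] by auto
  qed
  then obtain x' where x': "x' \<in> {x \<in> X. norm (\<Phi> x - t) \<le> E + ?K}"
    "infinite {n. (T ^^ n) (y n) = x'}"
    by (rule infinite_nat_pigeonhole[OF finite_X_bounded])
  from infinite_imp_nonempty[OF x'(2)] y(1) have "T x' = x" by (auto simp: P_def)
  moreover have "t \<in> S x'"
    by (rule tileI[of _ _ ?K], rule infinite_super[OF _ x'(2)]) (use y yX in \<open>auto simp: P_def\<close>)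
  ultimately show ?thesis using that x'(1) by blast
qed

lemma tile_subdivision_power:
  assumes "x \<in> X" "(M ^^ n) t \<in> S x"
  shows "\<exists>x'\<in>X. (T ^^ n) x' = x \<and> t \<in> S x'"
  using assms
proof (induction n arbitrary: t)
  case (Suc n)
  then have "(M ^^ n) (M t) \<in> S x" by (simp add: funpow_swap1)
  with Suc obtain x1 where x1: "(T ^^ n) x1 = x" "M t \<in> S x1" by blast
  from x1(2) obtain x' where "x' \<in> X" "T x' = x1" "t \<in> S x'" by (rule tile_subdivision)
  with x1(1) show ?case by (intro bexI[of _ x']) (auto simp: funpow_swap1)
qed auto

lemma degree_at_M_power_le: "degree_at X S ((M ^^ n) t) \<le> degree_at X S t"
proof -
  have "\<forall>x\<in>{x \<in> X. (M ^^ n) t \<in> S x}. \<exists>x'\<in>X. (T ^^ n) x' = x \<and> t \<in> S x'"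
    using tile_subdivision_power by blast
  then obtain f where f: "\<And>x. x \<in> X \<Longrightarrow> (M ^^ n) t \<in> S x \<Longrightarrow> f x \<in> X \<and> (T ^^ n) (f x) = x \<and> t \<in> S (f x)"
    by (metis (no_types, lifting) mem_Collect_eq)
  \<comment> \<open>\<open>T ^^ n\<close> recovers \<open>x\<close> from \<open>f x\<close>, so
    distinct tiles at \<open>(M ^^ n) t\<close> yield distinct tiles at \<open>t\<close>.\<close>
  then have "inj_on f {x \<in> X. (M ^^ n) t \<in> S x}"
    by (intro inj_onI) (metis (mono_tags, lifting) mem_Collect_eq)
  then show ?thesis unfolding degree_at_def
    by (rule card_inj_on_le) (use f finite_tiles_at in auto)
qed

section \<open>Small translations and the recurrence of low degrees\<close>

lemma T_power_shift:
  assumes "y \<in> {0..<1}" "0 \<le> z" "z \<le> (T ^^ n) y"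
  shows "y - z / \<beta> ^ n \<in> {0..<1} \<and> (T ^^ n) (y - z / \<beta> ^ n) = (T ^^ n) y - z"
  using assms
proof (induction n arbitrary: y z)
  case (Suc n)
  let ?w = "(T ^^ n) y"
  have w: "?w \<in> {0..<1}" using Suc.prems(1) beta_map_in_unit[of \<beta>] by (cases n) auto
  have Tw: "T ?w = (T ^^ Suc n) y" by simp
  have fl: "0 \<le> \<lfloor>\<beta> * ?w\<rfloor>" using w beta_gt_1 by auto
  \<comment> \<open>\<open>T ?w\<close> is \<open>\<beta> * ?w\<close> minus a nonnegative digit, so
    the decrement \<open>z / \<beta>\<close> is permitted one step earlier.\<close>
  have "z \<le> \<beta> * ?w"
    using Suc.prems(3) fl unfolding Tw[symmetric] beta_map_def[of _ ?w] by linarith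
  then have "z / \<beta> \<le> ?w" using beta_gt_1 by (simp add: field_simps)
  with Suc.IH[of y "z / \<beta>"] Suc.prems beta_gt_1 have
    1: "y - z / \<beta> ^ Suc n \<in> {0..<1}" "(T ^^ n) (y - z / \<beta> ^ Suc n) = ?w - z / \<beta>"
    by (auto simp: mult.commute)
  \<comment> \<open>The new remainder \<open>T ?w - z\<close> still lies in \<open>[0, 1)\<close>,
    hence the digit is unchanged.\<close>
  have "\<lfloor>\<beta> * ?w - z\<rfloor> = \<lfloor>\<beta> * ?w\<rfloor>"
    using Suc.prems(2,3) unfolding Tw[symmetric] beta_map_def[of _ ?w] by linarith
  then have "T (?w - z / \<beta>) = T ?w - z"
    using beta_gt_1 by (simp add: beta_map_def right_diff_distrib)
  with 1 show ?case by simp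
qed auto

text \<open>No smallness of \<open>z\<close> is required: decreasing the last remainder never borrows from a digit.\<close>

lemma P_shift:
  assumes "y \<in> P n (w + \<beta> ^ n * z)" "z \<in> Z" "0 \<le> z" "0 \<le> w"
  shows "y - z \<in> P n w"
proof -
  from assms beta_gt_1 have "y - z \<in> {0..<1} \<and> (T ^^ n) (y - z) = w"
    using T_power_shift[of y "\<beta> ^ n * z" n] by (auto simp: P_def)
  moreover have "y - z \<in> Z" using assms by (auto simp: P_def intro: diff_in)
  ultimately show ?thesis by (auto simp: P_def)
qed

text \<open>For suitable \<open>n\<close> and \<open>z\<close>, if
  \<open>t\<^sub>0 + \<Phi> (\<beta> ^ n * z)\<close> lies in the tile of \<open>x\<close>, then
  \<open>t\<^sub>0\<close> lies in the tile of \<open>x - \<beta> ^ n * z\<close>. This shift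
  injects the tiles at the translated point into those at \<open>t\<^sub>0\<close>.\<close>

lemma degree_at_recurrence:
  obtains R where "\<And>a. \<exists>t. norm (t - a) \<le> R \<and> degree_at X S t \<le> degree_at X S t\<^sub>0"
proof -
  define W where "W = {w \<in> Z. \<bar>w\<bar> \<le> 1 \<and> norm (\<Phi> w - t\<^sub>0) \<le> E + 1}"
  have finW: "finite W"
  proof (rule finite_subset[OF _ lattice_discrete[of "max 1 (E + 1 + norm t\<^sub>0)"]], unfold W_def, safe)
    fix x :: real assume "\<bar>x\<bar> \<le> 1" "norm (\<Phi> x - t\<^sub>0) \<le> E + 1"
    then show "\<bar>x\<bar> \<le> max 1 (E + 1 + norm t\<^sub>0)" "norm (\<Phi> x) \<le> max 1 (E + 1 + norm t\<^sub>0)"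
      using norm_triangle_ineq[of "\<Phi> x - t\<^sub>0" t\<^sub>0] by auto
  qed
  \<comment> \<open>By \<open>tileI\<close>, an index \<open>w\<close> whose tile misses
    \<open>t\<^sub>0\<close> satisfies \<open>Q n w\<close> for finitely many \<open>n\<close> only;
    as \<open>W\<close> is finite, one level excludes all such indices at once.\<close>
  define Q where "Q = (\<lambda>n w. \<exists>y\<in>P n w. norm (\<Phi> (\<beta> ^ n * y) - t\<^sub>0) \<le> (E + 1) * \<rho> ^ n)"
  have "\<forall>\<^sub>F n in sequentially. \<forall>w\<in>{w \<in> W. t\<^sub>0 \<notin> S w}. \<not> Q n w"
  proof (rule eventually_ball_finite)
    show "finite {w \<in> W. t\<^sub>0 \<notin> S w}" using finW by simp
    show "\<forall>w\<in>{w \<in> W. t\<^sub>0 \<notin> S w}. \<forall>\<^sub>F n in sequentially. \<not> Q n w"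
    proof
      fix w assume "w \<in> {w \<in> W. t\<^sub>0 \<notin> S w}"
      then have "finite {n. Q n w}" using tileI[of w t\<^sub>0 "E + 1"] unfolding Q_def by auto
      then show "\<forall>\<^sub>F n in sequentially. \<not> Q n w"
        by (simp add: cofinite_eq_sequentially[symmetric] eventually_cofinite)
    qed
  qed
  then obtain n where n: "\<And>w. w \<in> W \<Longrightarrow> Q n w \<Longrightarrow> t\<^sub>0 \<in> S w"
    by (auto simp: eventually_sequentially)
  \<comment> \<open>No negative element of \<open>W\<close> exceeds \<open>- \<epsilon>\<close>.
    Inserting 1 keeps the minimum defined and yields \<open>\<epsilon> \<le> 1\<close>, which puts
    the shifted index into \<open>W\<close>.\<close>
  define \<epsilon> where "\<epsilon> = Min (insert 1 (uminus ` {w \<in> W. w < 0}))"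
  have fin: "finite (insert 1 (uminus ` {w \<in> W. w < 0}))" using finW by simp
  have \<epsilon>: "\<epsilon> > 0" unfolding \<epsilon>_def by (subst Min_gr_iff[OF fin]) auto
  have \<epsilon>1: "\<epsilon> \<le> 1" unfolding \<epsilon>_def using fin by (intro Min_le) auto
  have \<epsilon>W: "w \<ge> 0" if "w \<in> W" "w > - \<epsilon>" for w
  proof (rule ccontr)
    assume "\<not> w \<ge> 0"
    with that(1) have "\<epsilon> \<le> - w" unfolding \<epsilon>_def using fin by (intro Min_le) auto
    with that show False by simp
  qed
  have "\<epsilon> / \<beta> ^ n > 0" using \<epsilon> beta_gt_1 by simp
  from X_relatively_dense[OF this] obtain R where
    R: "\<And>t. \<exists>x\<in>Z. 0 \<le> x \<and> x < \<epsilon> / \<beta> ^ n \<and> norm (\<Phi> x - t) \<le> R" by blast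
  have "\<exists>t. norm (t - a) \<le> R \<and> degree_at X S t \<le> degree_at X S t\<^sub>0" for a
  proof -
    obtain a' where a': "(M ^^ n) a' = a - t\<^sub>0" using surj_M_power by (metis surjD)
    obtain z where z: "z \<in> Z" "0 \<le> z" "z < \<epsilon> / \<beta> ^ n" "norm (\<Phi> z - a') \<le> R" using R by blast
    let ?z = "\<beta> ^ n * z" and ?t = "t\<^sub>0 + \<Phi> (\<beta> ^ n * z)"
    have zZ: "?z \<in> Z" and z0: "0 \<le> ?z" "?z < \<epsilon>"
      using z beta_gt_1 by (auto intro!: mult_in power_in simp: field_simps)
    have "?t - a = (M ^^ n) (\<Phi> z - a')"
      using z linear_M_power[of n] a' by (simp add: Phi_power linear_diff)
    then have "norm (?t - a) \<le> \<rho> ^ n * norm (\<Phi> z - a')" using norm_M_power by simp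
    also have "\<dots> \<le> 1 * norm (\<Phi> z - a')" using rho by (intro mult_right_mono power_le_one) auto
    finally have "norm (?t - a) \<le> R" using z by simp
    moreover have "x - ?z \<in> {x \<in> X. t\<^sub>0 \<in> S x}" if x: "x \<in> X" "?t \<in> S x" for x
    proof -
      let ?w = "x - ?z"
      have wZ: "?w \<in> Z" using x zZ by (auto intro: diff_in)
      have "norm (\<Phi> ?w - t\<^sub>0) \<le> E + 1"
        using tile_near[OF x(2)] x zZ by (simp add: Phi_diff diff_diff_eq add.commute)
      with wZ x z0 \<epsilon>1 have "?w \<in> W" by (auto simp: W_def)
      moreover have "?w > - \<epsilon>" using x z0 by auto
      ultimately have w0: "?w \<ge> 0" by (rule \<epsilon>W)
      from x(2) obtain y where y: "y \<in> P n x" "norm (\<Phi> (\<beta> ^ n * y) - ?t) \<le> (E + 1) * \<rho> ^ n"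
        by (rule tileD)
      from y(1) have "y - z \<in> P n ?w" using P_shift[of y n ?w z] z w0 by simp
      moreover have "y \<in> Z" using y by (auto simp: P_def)
      then have "\<Phi> (\<beta> ^ n * (y - z)) - t\<^sub>0 = \<Phi> (\<beta> ^ n * y) - ?t"
        using z by (simp add: right_diff_distrib Phi_diff mult_in power_in)
      with y(2) have "norm (\<Phi> (\<beta> ^ n * (y - z)) - t\<^sub>0) \<le> (E + 1) * \<rho> ^ n" by (simp only:)
      ultimately have "Q n ?w" unfolding Q_def by blast
      with n \<open>?w \<in> W\<close> have "t\<^sub>0 \<in> S ?w" by blast
      with wZ w0 x z0 show ?thesis by auto
    qed
    then have "degree_at X S ?t \<le> degree_at X S t\<^sub>0" unfolding degree_at_def
      by (intro card_inj_on_le[where f = "\<lambda>x. x - ?z"] finite_tiles_at inj_onI) auto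
    ultimately show ?thesis by blast
  qed
  then show ?thesis using that by blast
qed

section \<open>The weak tiling properties\<close>

lemma covering_degree_attained: "\<exists>t. degree_at X S t = covering_degree X S"
proof -
  have "(INF t. degree_at X S t) \<in> range (degree_at X S)" by (rule Inf_nat_def1) auto
  then show ?thesis unfolding covering_degree_def by (metis rangeE)
qed

lemma covering_degree_le: "covering_degree X S \<le> degree_at X S t"
  unfolding covering_degree_def by (rule cINF_lower) auto

lemma covering_degree_ge_1: "covering_degree X S \<ge> 1"
proof -
  obtain t where t: "degree_at X S t = covering_degree X S" using covering_degree_attained by blast
  have "{x \<in> X. t \<in> S x} \<noteq> {}" using tiles_cover[of t] by auto
  then show ?thesis using finite_tiles_at[of t] t
    by (simp add: degree_at_def Suc_le_eq card_gt_0_iff flip: t)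
qed

text \<open>The radius \<open>R\<close> is uniform in \<open>a\<close>, so the ball pulled back by a
  high power of \<open>M\<close> contains a point of minimal degree; by
  \<open>degree_at_M_power_le\<close>, its image in the original ball has minimal degree as
  well.\<close>

lemma interiors_disjoint:
  assumes "J \<subseteq> X" "card J = covering_degree X S + 1"
  shows "(\<Inter>i\<in>J. interior (S i)) = {}"
proof (rule ccontr)
  \<comment> \<open>An infinite \<open>J\<close> would have \<open>card J = 0\<close>. Finiteness
    makes the intersection of the interiors open.\<close>
  have finJ: "finite J" using assms(2) by (intro card_ge_0_finite) simp
  assume "\<not> ?thesis"
  then obtain t where "t \<in> (\<Inter>i\<in>J. interior (S i))" by blast
  moreover have "open (\<Inter>i\<in>J. interior (S i))" using finJ by auto
  ultimately obtain r where r: "r > 0" "ball t r \<subseteq> (\<Inter>i\<in>J. interior (S i))"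
    by (meson open_contains_ball)
  have deg: "covering_degree X S + 1 \<le> degree_at X S u" if "u \<in> ball t r" for u
    unfolding assms(2)[symmetric] degree_at_def
  proof (rule card_mono)
    show "J \<subseteq> {i \<in> X. u \<in> S i}"
      using that r(2) assms(1) interior_subset by blast
  qed (rule finite_tiles_at)
  obtain t\<^sub>0 where t0: "degree_at X S t\<^sub>0 = covering_degree X S" using covering_degree_attained by blast
  obtain R where R: "\<And>a. \<exists>t. norm (t - a) \<le> R \<and> degree_at X S t \<le> degree_at X S t\<^sub>0"
    using degree_at_recurrence by blast
  obtain n where n: "R * \<rho> ^ n < r"
    using rho_power_small[OF r(1), of R] by (auto simp: eventually_sequentially)
  obtain a where a: "(M ^^ n) a = t" using surj_M_power by (metis surjD)
  obtain t' where t': "norm (t' - a) \<le> R" "degree_at X S t' \<le> degree_at X S t\<^sub>0" using R by blast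
  have "norm ((M ^^ n) t' - t) \<le> \<rho> ^ n * norm (t' - a)"
    using norm_M_power[of n "t' - a"] a by (simp add: linear_diff[OF linear_M_power])
  also have "\<dots> \<le> \<rho> ^ n * R" using t' rho by (intro mult_left_mono) auto
  finally have "(M ^^ n) t' \<in> ball t r" using n by (simp add: dist_norm norm_minus_commute mult.commute)
  from deg[OF this] degree_at_M_power_le[of n t'] t'(2) t0 show False by simp
qed

theorem weak_m_tiling_tiles: "weak_m_tiling (covering_degree X S) X S"
  unfolding weak_m_tiling_def
  using locally_finite_tiles compact_tile tiles_cover interiors_disjoint by auto

theorem weak_tiling_tiles:
  assumes fin: "\<And>x. x \<in> X \<Longrightarrow> \<exists>n. (T ^^ n) x = 0"
  shows "weak_tiling X S"
proof -
  have T0: "(T ^^ n) 0 = 0" for n by (induction n) (auto simp: beta_map_def)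
  obtain f where f: "\<And>x. x \<in> X \<Longrightarrow> (T ^^ f x) x = 0" using fin by metis
  \<comment> \<open>A common time by which the finitely many indices whose tiles contain 0 have
    reached the fixed point 0.\<close>
  define N where "N = Max (f ` {x \<in> X. 0 \<in> S x})"
  have N: "(T ^^ N) x = 0" if "x \<in> X" "0 \<in> S x" for x
  proof -
    have "f x \<le> N" unfolding N_def using that finite_tiles_at[of 0] by (intro Max_ge) auto
    then have "(T ^^ N) x = (T ^^ (N - f x)) ((T ^^ f x) x)"
      by (metis comp_apply funpow_add le_add_diff_inverse2)
    then show ?thesis using f[OF that(1)] T0 by simp
  qed
  have "{x \<in> X. 0 \<in> S x} \<subseteq> {0}"
  proof
    fix x assume x: "x \<in> {x \<in> X. 0 \<in> S x}"
    \<comment> \<open>\<open>M\<close> fixes 0, so subdivision writes \<open>x\<close> as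
      \<open>(T ^^ N) x'\<close> with 0 in the tile of \<open>x'\<close>; this is 0 by the choice of
      \<open>N\<close>.\<close>
    then have "(M ^^ N) 0 \<in> S x" using linear_0[OF linear_M_power] by simp
    with x tile_subdivision_power[of x N 0] N show "x \<in> {0}" by auto
  qed
  then have "degree_at X S 0 \<le> card {0::real}" unfolding degree_at_def by (intro card_mono) auto
  with covering_degree_le[of 0] covering_degree_ge_1 have "covering_degree X S = 1" by simp
  with weak_m_tiling_tiles show ?thesis by simp
qed

end

section \<open>Evaluation of rational and integer polynomials\<close>

abbreviation rat_eval :: "rat poly \<Rightarrow> 'a::field_char_0 \<Rightarrow> 'a" where
  "rat_eval q \<equiv> poly (map_poly of_rat q)"

abbreviation int_eval :: "int poly \<Rightarrow> 'a::comm_ring_1 \<Rightarrow> 'a" where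
  "int_eval q \<equiv> poly (map_poly of_int q)"

lemma map_poly_add:
  assumes "h 0 = 0" "\<And>a b. h (a + b) = h a + h b"
  shows "map_poly h (p + q) = map_poly h p + map_poly h q"
  by (rule poly_eqI) (simp add: coeff_map_poly assms)

lemma map_poly_mult:
  fixes h :: "'a::comm_ring_1 \<Rightarrow> 'b::comm_ring_1"
  assumes "h 0 = 0" "\<And>a b. h (a + b) = h a + h b" "\<And>a b. h (a * b) = h a * h b"
  shows "map_poly h (p * q) = map_poly h p * map_poly h q"
proof (rule poly_eqI)
  fix n
  have "h (\<Sum>i\<le>n. coeff p i * coeff q (n - i)) = (\<Sum>i\<le>n. h (coeff p i * coeff q (n - i)))"
    using sum_comp_morphism[of h, OF assms(1,2), of "\<lambda>i. coeff p i * coeff q (n - i)" "{..n}"]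
    by (simp add: o_def)
  then show "coeff (map_poly h (p * q)) n = coeff (map_poly h p * map_poly h q) n"
    by (simp add: coeff_map_poly coeff_mult assms)
qed

lemma rat_eval_add: "rat_eval (p + q) z = rat_eval p z + rat_eval q z"
  by (simp add: map_poly_add of_rat_add)

lemma rat_eval_mult: "rat_eval (p * q) z = rat_eval p z * rat_eval q z"
  by (simp add: map_poly_mult of_rat_add of_rat_mult)

lemma rat_eval_pCons: "rat_eval (pCons a q) z = of_rat a + z * rat_eval q z"
  by (simp add: map_poly_pCons)

lemma rat_eval_smult: "rat_eval (smult a q) z = of_rat a * rat_eval q z"
  by (simp add: map_poly_smult of_rat_mult)

lemma rat_eval_diff: "rat_eval (p - q) z = rat_eval p z - rat_eval q z"
  using rat_eval_add[of "p - q" q z] by simp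

lemma rat_eval_of_real:
  "rat_eval q (of_real x :: 'a::{real_div_algebra,field_char_0}) = of_real (rat_eval q x)"
proof (induction q)
  case (pCons a q)
  have "of_real (of_rat a) = (of_rat a :: 'a)"
    by (cases a rule: Rat_cases) (simp add: of_rat_rat)
  with pCons show ?case by (simp add: rat_eval_pCons)
qed simp

lemma int_eval_add: "int_eval (p + q) z = int_eval p z + int_eval q z"
  by (simp add: map_poly_add)

lemma int_eval_mult: "int_eval (p * q) z = int_eval p z * int_eval q z"
  by (simp add: map_poly_mult)

lemma int_eval_pCons: "int_eval (pCons a q) z = of_int a + z * int_eval q z"
  by (simp add: map_poly_pCons)

lemma int_eval_smult: "int_eval (smult a q) z = of_int a * int_eval q z"
  by (simp add: map_poly_smult)

lemma int_eval_sum: "int_eval (\<Sum>i\<in>A. f i) z = (\<Sum>i\<in>A. int_eval (f i) z)"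
  by (induction A rule: infinite_finite_induct) (auto simp: int_eval_add)

lemma int_eval_of_real:
  "int_eval q (of_real x :: 'a::{real_algebra_1,comm_ring_1}) = of_real (int_eval q x)"
  by (induction q) (auto simp: int_eval_pCons)

lemma rat_eval_of_int_poly: "rat_eval (map_poly of_int q) z = int_eval q z"
  by (simp add: map_poly_map_poly o_def)

text \<open>Otherwise the polynomials are coprime, and evaluating a Bezout identity at
  \<open>z\<close> gives \<open>0 = 1\<close>.\<close>

lemma irreducible_dvd_of_common_root:
  fixes z :: "'a::field_char_0"
  assumes "irreducible f" "rat_eval f z = 0" "rat_eval q z = 0"
  shows "f dvd q"
proof (rule ccontr)
  assume "\<not> f dvd q"
  with assms(1) have "gcd f q = 1"
    by (intro coprime_imp_gcd_eq_1 prime_elem_imp_coprime irreducible_imp_prime_elem)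
  then have "fst (bezout_coefficients f q) * f + snd (bezout_coefficients f q) * q = 1"
    using bezout_coefficients_fst_snd[of f q] by simp
  from arg_cong[OF this, of "\<lambda>p. rat_eval p z"] assms show False
    by (simp add: rat_eval_add rat_eval_mult)
qed

text \<open>The right-hand side does not mention \<open>z\<close>: all roots of \<open>f\<close>
  satisfy the same relations, so conjugation is well defined and injective.\<close>

lemma rat_eval_eq_iff:
  fixes z :: "'a::field_char_0"
  assumes "irreducible f" "rat_eval f z = 0"
  shows "rat_eval p z = rat_eval q z \<longleftrightarrow> f dvd p - q"
proof
  assume "rat_eval p z = rat_eval q z"
  with assms show "f dvd p - q"
    by (intro irreducible_dvd_of_common_root) (auto simp: rat_eval_diff)
next
  assume "f dvd p - q"
  then obtain k where "p - q = f * k" by (elim dvdE)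
  from arg_cong[OF this, of "\<lambda>p. rat_eval p z"] assms show "rat_eval p z = rat_eval q z"
    by (simp add: rat_eval_diff rat_eval_mult)
qed

section \<open>The minimal polynomial\<close>

text \<open>Take a nonzero rational polynomial of least degree vanishing at \<beta>. One of any two
  factors vanishes at \<beta>, so minimality makes the other constant.\<close>

lemma min_poly_exists:
  fixes \<beta> :: real
  assumes "algebraic_int \<beta>"
  shows "\<exists>q. lead_coeff q = 1 \<and> irreducible q \<and> rat_eval q \<beta> = 0"
proof -
  obtain p where p: "int_eval p \<beta> = 0" "lead_coeff p = 1"
    using assms unfolding algebraic_int_altdef_ipoly by blast
  define V where "V = (\<lambda>q :: rat poly. q \<noteq> 0 \<and> rat_eval q \<beta> = 0)"
  have "V (map_poly of_int p)"
    using p by (auto simp: V_def rat_eval_of_int_poly map_poly_eq_0_iff)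
  define q0 where "q0 = arg_min degree V"
  have q0: "V q0" "\<And>q. V q \<Longrightarrow> degree q0 \<le> degree q"
    unfolding q0_def using \<open>V (map_poly of_int p)\<close> by (auto intro: arg_min_natI arg_min_nat_le)
  define q where "q = smult (inverse (lead_coeff q0)) q0"
  have q: "lead_coeff q = 1" "rat_eval q \<beta> = 0" "q \<noteq> 0"
    using q0(1) by (auto simp: q_def V_def rat_eval_smult)
  have min: "degree q \<le> degree r" if "V r" for r
    using q0(2)[OF that] q0(1) by (simp add: q_def V_def)
  have "irreducible q"
  proof (rule irreducibleI)
    show "\<not> q dvd 1"
    proof
      assume "q dvd 1"
      then obtain c where "q = [:c:]" using is_unit_poly_iff by blast
      moreover from this q(3) have "c \<noteq> 0" by simp
      ultimately have "q = [:c:]" "c \<noteq> 0" by auto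
      with q(2) show False by (simp add: rat_eval_pCons)
    qed
  next
    fix g h assume gh: "q = g * h"
    with q(3) have nz: "g \<noteq> 0" "h \<noteq> 0" by auto
    then have deg: "degree q = degree g + degree h" by (simp add: gh degree_mult_eq)
    from q(2) have "rat_eval g \<beta> = 0 \<or> rat_eval h \<beta> = 0" by (simp add: gh rat_eval_mult)
    then have "degree h = 0 \<or> degree g = 0"
      using min[of g] min[of h] nz deg by (auto simp: V_def)
    then show "g dvd 1 \<or> h dvd 1" using nz by (auto simp: is_unit_iff_degree)
  qed (use q in auto)
  with q show ?thesis by blast
qed

text \<open>Two monic irreducible polynomials with a common root divide each other and hence agree,
  which justifies the definite description.\<close>

lemma min_poly:
  assumes "algebraic_int \<beta>"
  shows "lead_coeff (min_poly \<beta>) = 1" "irreducible (min_poly \<beta>)" "rat_eval (min_poly \<beta>) \<beta> = 0"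
proof -
  obtain q where q: "lead_coeff q = 1" "irreducible q" "rat_eval q \<beta> = 0"
    using min_poly_exists[OF assms] by blast
  have "\<exists>!q. lead_coeff q = 1 \<and> irreducible q \<and> rat_eval q \<beta> = 0"
  proof (rule ex1I[of _ q])
    fix r assume r: "lead_coeff r = 1 \<and> irreducible r \<and> rat_eval r \<beta> = 0"
    with q have "r dvd q" "q dvd r" by (auto intro: irreducible_dvd_of_common_root)
    then obtain k where k: "r = q * k" by (elim dvdE)
    from \<open>r dvd q\<close> q have "degree r \<le> degree q" by (intro dvd_imp_degree_le) auto
    with k r have "degree k = 0" by (cases "q = 0 \<or> k = 0") (auto simp: degree_mult_eq)
    then obtain a where "k = [:a:]" by (rule degree_eq_zeroE)
    moreover from this k r q have "a = 1" by (simp split: if_splits)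
    ultimately show "r = q" using k by simp
  qed (use q in auto)
  from theI'[OF this] show "lead_coeff (min_poly \<beta>) = 1" "irreducible (min_poly \<beta>)"
    "rat_eval (min_poly \<beta>) \<beta> = 0" unfolding min_poly_def by auto
qed

lemma clear_denominators:
  fixes f :: "rat poly"
  obtains a F where "a > 0" "smult (of_int a) f = map_poly of_int F"
proof -
  have "\<exists>a F. a > 0 \<and> smult (of_int a) f = map_poly of_int F"
  proof (induction f)
    case 0
    show ?case by (intro exI[of _ 1] exI[of _ 0]) auto
  next
    case (pCons c f)
    then obtain a F where a: "a > 0" "smult (of_int a) f = map_poly of_int F" by blast
    obtain m n where mn: "quotient_of c = (m, n)" by fastforce
    from quotient_of_denom_pos[OF mn] have n: "n > 0" .
    have c: "c = of_int m / of_int n" by (rule quotient_of_div[OF mn])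
    have "smult (of_int (a * n)) (pCons c f) = map_poly of_int (pCons (a * m) (smult n F))"
      using n a(2)[symmetric] by (simp add: map_poly_pCons map_poly_smult c mult.commute)
    then show ?case using a n by (intro exI[of _ "a * n"]) auto
  qed
  then show ?thesis using that by blast
qed

text \<open>Gauss's lemma. After clearing denominators by \<open>a\<close> and \<open>c\<close>, the
  contents of \<open>F\<close> and \<open>G\<close> divide \<open>a\<close> and \<open>c\<close> and
  have product \<open>a * c\<close>; so \<open>content F = a\<close>, and dividing it out of
  \<open>F\<close> returns \<open>f\<close>.\<close>

lemma monic_factor_int_poly:
  fixes f g :: "rat poly" and P :: "int poly"
  assumes P: "lead_coeff P = 1" "map_poly of_int P = f * g" and f: "lead_coeff f = 1"
  obtains F where "f = map_poly of_int F"
proof -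
  have "lead_coeff (f * g) = 1"
    using P by (simp flip: P(2) add: lead_coeff_map_poly_nz)
  then have g: "lead_coeff g = 1" by (simp add: lead_coeff_mult f)
  obtain a F where a: "a > 0" "smult (of_int a) f = map_poly of_int F" by (rule clear_denominators)
  obtain c G where c: "c > 0" "smult (of_int c) g = map_poly of_int G" by (rule clear_denominators)
  have "map_poly of_int (F * G) = (map_poly of_int (smult (a * c) P) :: rat poly)"
    by (simp add: map_poly_mult map_poly_smult P(2) a(2)[symmetric] c(2)[symmetric] mult.commute)
  then have "rat_of_int (coeff (F * G) n) = rat_of_int (coeff (smult (a * c) P) n)" for n
    by (metis coeff_map_poly of_int_0)
  then have FG: "F * G = smult (a * c) P"
    by (intro poly_eqI) (simp only: of_int_eq_iff)
  have "content P dvd 1" by (metis content_dvd_coeff P(1))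
  then have "content P = 1" by (simp only: is_unit_content_iff)
  then have "content (F * G) = a * c" unfolding FG content_smult using a(1) c(1) by simp
  then have cont: "content F * content G = a * c" unfolding content_mult .
  have "coeff F (degree f) = a"
    using arg_cong[OF a(2), of "\<lambda>p. coeff p (degree f)"] f by (simp add: coeff_map_poly)
  then have "content F dvd a" by (metis content_dvd_coeff)
  have "coeff G (degree g) = c"
    using arg_cong[OF c(2), of "\<lambda>p. coeff p (degree g)"] g by (simp add: coeff_map_poly)
  then have "content G dvd c" by (metis content_dvd_coeff)
  have "content F = a"
  proof (rule ccontr)
    assume "content F \<noteq> a"
    with zdvd_imp_le[OF \<open>content F dvd a\<close> a(1)] have "content F < a" by linarith
    moreover have "content G \<le> c" by (rule zdvd_imp_le[OF \<open>content G dvd c\<close> c(1)])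
    moreover have "content G > 0"
    proof -
      have "\<bar>content G\<bar> = content G" using normalize_content[of G] by (simp only: normalize_int_def)
      moreover have "content G \<noteq> 0" using cont a(1) c(1) by (intro notI) simp
      ultimately show ?thesis by linarith
    qed
    ultimately have "content F * content G < a * c"
      using a(1) mult_less_le_imp_less[of "content F" a "content G" c]
      by (metis abs_ge_zero normalize_content normalize_int_def)
    with cont show False by linarith
  qed
  then have "smult (of_int a) f = smult (of_int a) (map_poly of_int (primitive_part F))"
    using content_times_primitive_part[of F] a(2)
    by (metis map_poly_smult of_int_0 of_int_mult)
  then have "f = map_poly of_int (primitive_part F)"
    by (rule smult_cancel[rotated]) (use a(1) in simp)
  then show ?thesis using that by blast
qed

lemma min_poly_integral:
  assumes "algebraic_int \<beta>"
  obtains F where "min_poly \<beta> = map_poly of_int F" "lead_coeff F = 1"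
proof -
  obtain P where P: "int_eval P \<beta> = 0" "lead_coeff P = 1"
    using assms unfolding algebraic_int_altdef_ipoly by blast
  have "min_poly \<beta> dvd map_poly of_int P"
    using min_poly[OF assms] P by (intro irreducible_dvd_of_common_root) (auto simp: rat_eval_of_int_poly)
  then obtain g where "map_poly of_int P = min_poly \<beta> * g" by (elim dvdE)
  from monic_factor_int_poly[OF P(2) this min_poly(1)[OF assms]] obtain F
    where F: "min_poly \<beta> = map_poly of_int F" .
  then have "lead_coeff (min_poly \<beta>) = of_int (lead_coeff F)"
    by (simp add: coeff_map_poly degree_map_poly)
  with min_poly(1)[OF assms] F that show ?thesis by simp
qed

section \<open>Conjugates\<close>

text \<open>A multiple root would be shared with the derivative, which the irreducible minimal
  polynomial would then divide; this is impossible in characteristic 0.\<close>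

lemma min_poly_rsquarefree:
  assumes "algebraic_int \<beta>"
  shows "rsquarefree (map_poly of_rat (min_poly \<beta>) :: complex poly)"
  unfolding rsquarefree_roots
proof (intro allI notI, elim conjE)
  fix z :: complex
  let ?f = "min_poly \<beta>"
  assume z: "rat_eval ?f z = 0" "poly (pderiv (map_poly of_rat ?f)) z = 0"
  have "pderiv (map_poly of_rat ?f) = (map_poly of_rat (pderiv ?f) :: complex poly)"
    by (rule poly_eqI) (simp add: coeff_pderiv coeff_map_poly of_rat_mult of_rat_add)
  with z have "?f dvd pderiv ?f"
    by (intro irreducible_dvd_of_common_root[OF min_poly(2)[OF assms] z(1)]) simp
  moreover have "degree ?f \<noteq> 0"
    using min_poly(2)[OF assms] by (metis irreducible_def is_unit_iff_degree)
  ultimately show False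
    using not_dvd_pderiv by blast
qed

text \<open>The roots are simple, so the product needs no multiplicities. It yields the number of
  conjugates and the norm of \<beta>.\<close>

lemma min_poly_eq_prod:
  assumes "algebraic_int \<beta>"
  shows "map_poly of_rat (min_poly \<beta>) = (\<Prod>z\<in>galois_conjugates \<beta>. [:-z, 1:])"
proof -
  have "lead_coeff (map_poly of_rat (min_poly \<beta>) :: complex poly) = 1"
    using min_poly(1)[OF assms] by (simp add: coeff_map_poly degree_map_poly)
  then show ?thesis
    using complex_poly_decompose_rsquarefree[OF min_poly_rsquarefree[OF assms]]
    by (simp add: galois_conjugates_def)
qed

lemma card_galois_conjugates:
  assumes "algebraic_int \<beta>"
  shows "card (galois_conjugates \<beta>) = degree (min_poly \<beta>)" "finite (galois_conjugates \<beta>)"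
proof -
  let ?f = "map_poly of_rat (min_poly \<beta>) :: complex poly"
  have nz: "?f \<noteq> 0" using min_poly(1)[OF assms] by (auto simp: map_poly_eq_0_iff)
  show fin: "finite (galois_conjugates \<beta>)"
    unfolding galois_conjugates_def by (rule poly_roots_finite[OF nz])
  from min_poly_eq_prod[OF assms] have "degree ?f = card (galois_conjugates \<beta>)"
    by (simp add: degree_prod_sum_eq)
  then show "card (galois_conjugates \<beta>) = degree (min_poly \<beta>)" by (simp add: degree_map_poly)
qed

lemma min_poly_at_0:
  assumes "algebraic_int \<beta>"
  shows "cmod (rat_eval (min_poly \<beta>) 0) = (\<Prod>z\<in>galois_conjugates \<beta>. cmod z)"
proof -
  show ?thesis unfolding min_poly_eq_prod[OF assms] by (simp add: poly_prod norm_minus_cancel flip: prod_norm)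
qed

lemma is_subfield_rat_eval:
  fixes z :: complex
  assumes "is_subfield K" "z \<in> K"
  shows "rat_eval q z \<in> K"
proof -
  have diff: "x - y \<in> K" and mult: "x * y \<in> K" and inv: "inverse x \<in> K"
    if "x \<in> K" "y \<in> K" for x y
    using assms(1) that by (auto simp: is_subfield_def)
  have one: "1 \<in> K" using assms(1) by (auto simp: is_subfield_def)
  have zero: "0 \<in> K" using diff[OF one one] by simp
  have add: "x + y \<in> K" if "x \<in> K" "y \<in> K" for x y
    using diff[OF that(1) diff[OF zero that(2)]] by simp
  have nat: "of_nat n \<in> K" for n by (induction n) (auto intro: add one zero)
  have int: "of_int k \<in> K" for k
    using nat diff[OF zero nat] by (cases k rule: int_cases2) auto
  have rat: "of_rat r \<in> K" for r
  proof -
    obtain m n where "quotient_of r = (m, n)" by fastforce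
    from quotient_of_div[OF this] show ?thesis
      using mult[OF int inv[OF int int]] by (simp add: of_rat_mult of_rat_inverse divide_inverse)
  qed
  show ?thesis by (induction q) (auto simp: rat_eval_pCons intro!: zero add mult rat assms)
qed

text \<open>The polynomial values already form a field: a Bezout identity with \<open>f\<close>
  supplies the inverses.\<close>

lemma rat_adjoin_eq:
  assumes "irreducible f" "rat_eval f z = 0"
  shows "rat_adjoin z = range (\<lambda>q. rat_eval q z)"
proof
  have "is_subfield (range (\<lambda>q. rat_eval q z))"
    unfolding is_subfield_def
  proof (intro conjI ballI)
    show "1 \<in> range (\<lambda>q. rat_eval q z)" by (rule range_eqI[of _ _ 1]) simp
  next
    fix x y assume "x \<in> range (\<lambda>q. rat_eval q z)" "y \<in> range (\<lambda>q. rat_eval q z)"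
    then show "x - y \<in> range (\<lambda>q. rat_eval q z)" "x * y \<in> range (\<lambda>q. rat_eval q z)"
      by (auto simp flip: rat_eval_diff rat_eval_mult)
  next
    fix x assume "x \<in> range (\<lambda>q. rat_eval q z)"
    then obtain q where q: "x = rat_eval q z" by blast
    show "inverse x \<in> range (\<lambda>q. rat_eval q z)"
    proof (cases "x = 0")
      case True
      then show ?thesis by (intro range_eqI[of _ _ 0]) auto
    next
      case False
      have "\<not> f dvd q"
        using False assms(2) by (auto simp: q rat_eval_mult)
      with assms(1) have "gcd f q = 1"
        by (intro coprime_imp_gcd_eq_1 prime_elem_imp_coprime irreducible_imp_prime_elem)
      then have "fst (bezout_coefficients f q) * f + snd (bezout_coefficients f q) * q = 1"
        using bezout_coefficients_fst_snd[of f q] by simp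
      from arg_cong[OF this, of "\<lambda>p. rat_eval p z"] assms(2)
      have "rat_eval (snd (bezout_coefficients f q)) z * x = 1"
        by (simp add: rat_eval_add rat_eval_mult q)
      then have "inverse x = rat_eval (snd (bezout_coefficients f q)) z"
        using False by (simp add: field_simps)
      then show ?thesis by blast
    qed
  qed
  moreover have "z \<in> range (\<lambda>q. rat_eval q z)"
    by (rule range_eqI[of _ _ "[:0, 1:]"]) (simp add: rat_eval_pCons)
  ultimately show "rat_adjoin z \<subseteq> range (\<lambda>q. rat_eval q z)" by (auto simp: rat_adjoin_def)
  show "range (\<lambda>q. rat_eval q z) \<subseteq> rat_adjoin z"
    by (auto simp: rat_adjoin_def intro: is_subfield_rat_eval)
qed

text \<open>Existence of the isomorphism holds because evaluations at \<beta> and at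
  \<open>z\<close> satisfy the same relations; uniqueness because a field isomorphism fixes the
  rationals and is then determined by its value at \<beta>.\<close>

lemma conj_iso_rat_eval:
  fixes \<beta> :: real and z :: complex
  assumes f: "irreducible f" "rat_eval f (complex_of_real \<beta>) = 0" "rat_eval f z = 0"
  shows "conj_iso \<beta> z (rat_eval q (complex_of_real \<beta>)) = rat_eval q z"
proof -
  let ?b = "complex_of_real \<beta>"
  let ?Q = "range (\<lambda>q. rat_eval q ?b)" and ?R = "range (\<lambda>q. rat_eval q z)"
  note adj = rat_adjoin_eq[OF f(1,2)] rat_adjoin_eq[OF f(1,3)]
  let ?iso = "\<lambda>\<sigma>. \<sigma> \<in> extensional (rat_adjoin ?b) \<and>
     field_iso (rat_adjoin ?b) (rat_adjoin z) \<sigma> \<and> \<sigma> ?b = z"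
  have eq_iff: "rat_eval p ?b = rat_eval q ?b \<longleftrightarrow> rat_eval p z = rat_eval q z" for p q
    using rat_eval_eq_iff[OF f(1,2)] rat_eval_eq_iff[OF f(1,3)] by blast
  define \<sigma> where "\<sigma> = restrict (\<lambda>x. rat_eval (SOME q. rat_eval q ?b = x) z) ?Q"
  have \<sigma>: "\<sigma> (rat_eval q ?b) = rat_eval q z" for q
  proof -
    have "rat_eval (SOME q'. rat_eval q' ?b = rat_eval q ?b) ?b = rat_eval q ?b"
      by (rule someI) (rule refl)
    then show ?thesis by (simp add: \<sigma>_def eq_iff)
  qed
  have unique: "\<tau> (rat_eval q ?b) = rat_eval q z" if "?iso \<tau>" for \<tau> q
  proof -
    from that have inj: "inj_on \<tau> ?Q"
      and add': "\<And>x y. x \<in> ?Q \<Longrightarrow> y \<in> ?Q \<Longrightarrow> \<tau> (x + y) = \<tau> x + \<tau> y"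
      and mult': "\<And>x y. x \<in> ?Q \<Longrightarrow> y \<in> ?Q \<Longrightarrow> \<tau> (x * y) = \<tau> x * \<tau> y" and \<tau>b: "\<tau> ?b = z"
      unfolding adj field_iso_def bij_betw_def by auto
    define h where "h = (\<lambda>q. \<tau> (rat_eval q ?b))"
    have add: "h (p + q) = h p + h q" and mult: "h (p * q) = h p * h q" for p q
      unfolding h_def rat_eval_add rat_eval_mult by (auto intro: add' mult')
    have zero: "h 0 = 0" using add[of 0 0] by simp
    \<comment> \<open>\<open>field_iso\<close> does not postulate that 1 goes to 1: from
      \<open>h 1 * h 1 = h 1\<close>, injectivity excludes the value 0.\<close>
    have "h 1 \<noteq> h 0"
    proof
      assume "h 1 = h 0"
      then have "rat_eval 1 ?b = rat_eval 0 ?b" unfolding h_def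
        by (rule inj_onD[OF inj]) (rule rangeI)+
      then show False by simp
    qed
    then have one: "h 1 = 1" using mult[of 1 1] zero by simp
    have nat: "h [:of_nat n:] = of_nat n" for n
    proof (induction n)
      case (Suc n)
      have "h [:of_nat (Suc n):] = h (1 + [:of_nat n:])" by (simp add: one_pCons)
      then show ?case using Suc one by (simp only: add of_nat_Suc)
    qed (simp add: zero)
    have neg: "h (- q) = - h q" for q using add[of q "- q"] zero by (simp add: eq_neg_iff_add_eq_0 add.commute)
    have int: "h [:of_int k:] = of_int k" for k
      using nat neg[of "[:of_nat _:]"] by (cases k rule: int_cases2) auto
    have rat: "h [:r:] = of_rat r" for r
    proof -
      obtain m n where mn: "quotient_of r = (m, n)" by fastforce
      from quotient_of_denom_pos[OF mn] have n: "n > 0" .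
      have "[:of_int n:] * [:r:] = [:of_int m:]" using n by (simp add: quotient_of_div[OF mn])
      then have "of_int n * h [:r:] = of_int m" by (metis mult int)
      then show ?thesis using n by (simp add: quotient_of_div[OF mn] of_rat_divide field_simps)
    qed
    have X: "h [:0, 1:] = z" using \<tau>b by (simp add: h_def rat_eval_pCons)
    have "h q = rat_eval q z"
    proof (induction q)
      case (pCons a q)
      have "h (pCons a q) = h ([:a:] + [:0, 1:] * q)" by simp
      also have "\<dots> = of_rat a + z * h q" by (simp only: add mult rat X)
      finally show ?case using pCons by (simp add: rat_eval_pCons)
    qed (simp add: zero)
    then show ?thesis by (simp add: h_def)
  qed
  have "?iso \<sigma>"
  proof (intro conjI)
    show "\<sigma> \<in> extensional (rat_adjoin ?b)" by (simp add: \<sigma>_def adj)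
    show "\<sigma> ?b = z" using \<sigma>[of "[:0, 1:]"] by (simp add: rat_eval_pCons)
    show "field_iso (rat_adjoin ?b) (rat_adjoin z) \<sigma>"
      unfolding field_iso_def adj bij_betw_def
    proof (intro conjI ballI)
      show "inj_on \<sigma> ?Q" by (auto intro!: inj_onI simp: \<sigma> eq_iff)
      show "\<sigma> ` ?Q = ?R" by (auto simp: \<sigma> image_iff)
    next
      fix x y assume "x \<in> ?Q" "y \<in> ?Q"
      then show "\<sigma> (x + y) = \<sigma> x + \<sigma> y" "\<sigma> (x * y) = \<sigma> x * \<sigma> y"
        by (auto simp: \<sigma> simp flip: rat_eval_add rat_eval_mult)
    qed
  qed
  moreover have "\<tau> = \<sigma>" if "?iso \<tau>" for \<tau>
  proof
    fix x show "\<tau> x = \<sigma> x"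
    proof (cases "x \<in> ?Q")
      case True
      then show ?thesis using unique[OF that] by (auto simp: \<sigma>)
    next
      case False
      with that show ?thesis by (auto simp: adj \<sigma>_def extensional_def)
    qed
  qed
  ultimately have "conj_iso \<beta> z = \<sigma>" unfolding conj_iso_def by (rule the_equality)
  then show ?thesis by (simp add: \<sigma>)
qed

lemma galois_conjugates_of_real:
  assumes "algebraic_int \<beta>"
  shows "complex_of_real \<beta> \<in> galois_conjugates \<beta>"
  using min_poly(3)[OF assms] by (simp add: galois_conjugates_def rat_eval_of_real)

lemma conj_iso_int_eval:
  assumes "algebraic_int \<beta>" "z \<in> galois_conjugates \<beta>"
  shows "conj_iso \<beta> z (of_real (int_eval q \<beta>)) = int_eval q z"
  using conj_iso_rat_eval[OF min_poly(2)[OF assms(1)], of \<beta> z "map_poly of_int q"]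
    assms(2) galois_conjugates_of_real[OF assms(1)]
  by (simp add: galois_conjugates_def rat_eval_of_int_poly int_eval_of_real)

section \<open>Real coordinates of the conjugates\<close>

text \<open>The layout of \<open>Phi_list\<close> for arbitrary values, so that \<open>M\<close> and
  the lattice embedding can use the same coordinates.\<close>

definition real_coords :: "nat \<Rightarrow> nat \<Rightarrow> (nat \<Rightarrow> complex) \<Rightarrow> real list" where
  "real_coords p s f = map (\<lambda>j. Re (f j)) [1..<p + 1] @
     concat (map (\<lambda>j. [Re (f j), Im (f j)]) [p + 1..<p + s + 1])"

definition rank :: "'n::{finite,linorder} \<Rightarrow> nat" where
  "rank i = card {j. j < i}"

definition coords :: "nat \<Rightarrow> nat \<Rightarrow> (nat \<Rightarrow> complex) \<Rightarrow> real ^ 'n::{finite,linorder}" where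
  "coords p s f = (\<chi> i. real_coords p s f ! rank i)"

lemma Phi_eq_coords: "Phi \<beta> p s b x = coords p s (\<lambda>j. conj_iso \<beta> (b j) (of_real x))"
  by (simp add: Phi_def Phi_list_def coords_def real_coords_def rank_def)

lemma bij_betw_rank: "bij_betw (rank :: 'n::{finite,linorder} \<Rightarrow> nat) UNIV {..<CARD('n)}"
proof -
  have mono: "rank i < rank j" if "i < j" for i j :: 'n
    unfolding rank_def using that by (intro psubset_card_mono) auto
  have "inj (rank :: 'n \<Rightarrow> nat)"
    by (rule injI) (metis mono less_irrefl neqE)
  moreover have "rank i < CARD('n)" for i :: 'n
    unfolding rank_def by (intro psubset_card_mono) auto
  ultimately show ?thesis
    unfolding bij_betw_def by (intro conjI card_subset_eq) (auto simp: card_image)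
qed

lemma rank_less: "rank (i :: 'n::{finite,linorder}) < CARD('n)"
  using bij_betw_rank by (auto simp: bij_betw_def)

lemma rank_eq_iff: "rank i = rank j \<longleftrightarrow> i = j"
  using bij_betw_rank by (auto simp: bij_betw_def inj_on_def)

lemma length_real_coords [simp]: "length (real_coords p s f) = p + 2 * s"
  by (simp add: real_coords_def length_concat o_def sum_list_triv)

lemma nth_concat_pairs:
  assumes "j < length xs"
  shows "concat (map (\<lambda>j. [g j, h j]) xs) ! (2 * j) = g (xs ! j)"
    "concat (map (\<lambda>j. [g j, h j]) xs) ! Suc (2 * j) = h (xs ! j)"
  using assms
proof (induction xs arbitrary: j)
  case (Cons x xs)
  { case 1 then show ?case using Cons by (cases j) auto }
  { case 2 then show ?case using Cons by (cases j) auto }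
qed auto

lemma real_coords_nth:
  shows "k < p \<Longrightarrow> real_coords p s f ! k = Re (f (Suc k))"
    and "j < s \<Longrightarrow> real_coords p s f ! (p + 2 * j) = Re (f (Suc (p + j)))"
    and "j < s \<Longrightarrow> real_coords p s f ! Suc (p + 2 * j) = Im (f (Suc (p + j)))"
proof -
  show "k < p \<Longrightarrow> real_coords p s f ! k = Re (f (Suc k))"
    unfolding real_coords_def by (subst nth_append) (simp del: upt_Suc)
  assume j: "j < s"
  have xs: "j < length [p + 1..<p + s + 1]" "[p + 1..<p + s + 1] ! j = Suc (p + j)"
    using j by (simp_all del: upt_Suc)
  note n = nth_concat_pairs[OF xs(1), of "\<lambda>j. Re (f j)" "\<lambda>j. Im (f j)", unfolded xs(2)]
  show "real_coords p s f ! (p + 2 * j) = Re (f (Suc (p + j)))"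
    "real_coords p s f ! Suc (p + 2 * j) = Im (f (Suc (p + j)))"
    unfolding real_coords_def using n by (simp_all add: nth_append del: upt_Suc)
qed

lemma index_cases:
  fixes k p s :: nat
  assumes "k < p + 2 * s"
  obtains "k < p" | j where "j < s" "k = p + 2 * j" | j where "j < s" "k = Suc (p + 2 * j)"
proof (cases "k < p")
  case False
  define j where "j = (k - p) div 2"
  have "j < s" "k = p + 2 * j \<or> k = Suc (p + 2 * j)"
    using False assms unfolding j_def by presburger+
  then show ?thesis using that by blast
qed

lemma real_coords_linear:
  assumes "k < p + 2 * s"
  shows "real_coords p s (\<lambda>j. f j + g j) ! k = real_coords p s f ! k + real_coords p s g ! k"
    "real_coords p s (\<lambda>j. of_real c * f j) ! k = c * real_coords p s f ! k"
  using assms by (cases k p s rule: index_cases; simp add: real_coords_nth)+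

locale tile_coords =
  fixes p s :: nat and dim :: "'n::{finite,linorder} itself"
  assumes CARD_dim: "CARD('n) = p + 2 * s"
begin

abbreviation vec_of :: "(nat \<Rightarrow> complex) \<Rightarrow> real ^ 'n::{finite,linorder}" where
  "vec_of \<equiv> coords p s"

text \<open>At the real places \<open>vec_of\<close> keeps only real parts; on families that are
  real there it loses nothing at the indices \<open>1..p + s\<close>.\<close>

definition admissible :: "(nat \<Rightarrow> complex) \<Rightarrow> bool" where
  "admissible f \<longleftrightarrow> (\<forall>j\<in>{1..p}. f j \<in> \<real>)"

lemma vec_of_add: "vec_of (\<lambda>j. f j + g j) = vec_of f + vec_of g"
  using rank_less[where 'n = 'n] by (simp add: vec_eq_iff coords_def real_coords_linear CARD_dim)

lemma vec_of_scale: "vec_of (\<lambda>j. of_real c * f j) = c *\<^sub>R vec_of f"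
  using rank_less[where 'n = 'n] by (simp add: vec_eq_iff coords_def real_coords_linear CARD_dim)

text \<open>A complex place contributes the squares of both its parts, a real one has no imaginary
  part. In this form componentwise multiplication is easy to bound.\<close>

lemma norm_vec_of:
  assumes "admissible f"
  shows "(norm (vec_of f))\<^sup>2 = (\<Sum>j\<in>{1..p + s}. (cmod (f j))\<^sup>2)"
proof -
  let ?l = "real_coords p s f"
  have "(norm (vec_of f))\<^sup>2 = (\<Sum>i\<in>UNIV. (?l ! rank (i :: 'n))\<^sup>2)"
    by (simp add: norm_vec_def L2_set_def coords_def sum_nonneg)
  also have "\<dots> = (\<Sum>k<p + 2 * s. (?l ! k)\<^sup>2)"
    using sum.reindex_bij_betw[OF bij_betw_rank[where 'n = 'n], of "\<lambda>k. (?l ! k)\<^sup>2"]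
    by (simp add: CARD_dim)
  also have "\<dots> = sum_list (map (\<lambda>x. x\<^sup>2) ?l)"
    by (simp add: sum_list_sum_nth atLeast0LessThan)
  also have "\<dots> = (\<Sum>j\<leftarrow>[1..<p + 1]. (Re (f j))\<^sup>2) + (\<Sum>j\<leftarrow>[p + 1..<p + s + 1]. (cmod (f j))\<^sup>2)"
  proof -
    have "sum_list (map (\<lambda>x. x\<^sup>2) (concat (map (\<lambda>j. [Re (f j), Im (f j)]) xs))) =
        (\<Sum>j\<leftarrow>xs. (cmod (f j))\<^sup>2)" for xs
      by (induction xs) (auto simp: cmod_power2)
    then show ?thesis by (simp add: real_coords_def o_def del: upt_Suc)
  qed
  also have "(\<Sum>j\<leftarrow>[1..<p + 1]. (Re (f j))\<^sup>2) = (\<Sum>j\<leftarrow>[1..<p + 1]. (cmod (f j))\<^sup>2)"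
    using assms unfolding admissible_def
    by (intro arg_cong[of _ _ sum_list] map_cong) (auto simp: cmod_power2 complex_is_Real_iff)
  also have "\<dots> + (\<Sum>j\<leftarrow>[p + 1..<p + s + 1]. (cmod (f j))\<^sup>2) =
      (\<Sum>j\<leftarrow>[1..<p + 1] @ [p + 1..<p + s + 1]. (cmod (f j))\<^sup>2)" by simp
  also have "[1..<p + 1] @ [p + 1..<p + s + 1] = [1..<p + s + 1]"
    using upt_add_eq_append[of 1 "p + 1" s] by (simp add: add.commute add.left_commute del: upt_Suc)
  also have "(\<Sum>j\<leftarrow>[1..<p + s + 1]. (cmod (f j))\<^sup>2) = (\<Sum>j\<in>{1..p + s}. (cmod (f j))\<^sup>2)"
    by (simp add: interv_sum_list_conv_sum_set_nat atLeastLessThanSuc_atLeastAtMost del: upt_Suc)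
  finally show ?thesis .
qed

lemma vec_of_onto: "\<exists>f. admissible f \<and> vec_of f = t"
proof -
  define \<iota> where "\<iota> = inv_into UNIV (rank :: 'n \<Rightarrow> nat)"
  have \<iota>: "\<iota> (rank i) = i" for i
    using bij_betw_inv_into_left[OF bij_betw_rank[where 'n = 'n]] by (simp add: \<iota>_def)
  \<comment> \<open>Inverts the layout: a real index \<open>j\<close> sits at position
    \<open>j - 1\<close>, a complex one at \<open>p + 2 * (j - Suc p)\<close> and the next
    position.\<close>
  define f where "f = (\<lambda>j. if j \<le> p then of_real (t $ \<iota> (j - 1)) else
    Complex (t $ \<iota> (p + 2 * (j - Suc p))) (t $ \<iota> (Suc (p + 2 * (j - Suc p)))))"
  have "real_coords p s f ! k = t $ \<iota> k" if "k < p + 2 * s" for k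
    using that by (cases k p s rule: index_cases) (auto simp: real_coords_nth f_def)
  then have "vec_of f = t"
    using rank_less[where 'n = 'n] by (simp add: vec_eq_iff coords_def CARD_dim \<iota>)
  moreover have "admissible f" by (auto simp: admissible_def f_def)
  ultimately show ?thesis by blast
qed

text \<open>A right inverse of \<open>vec_of\<close>. Its values are determined by \<open>t\<close>
  only at \<open>1..p + s\<close>, hence the index restrictions below.\<close>

definition cpx :: "real ^ 'n::{finite,linorder} \<Rightarrow> nat \<Rightarrow> complex" where
  "cpx t = (SOME f. admissible f \<and> vec_of f = t)"

lemma cpx: "admissible (cpx t)" "vec_of (cpx t) = t"
  using someI_ex[OF vec_of_onto[of t]] by (auto simp: cpx_def)

lemma norm_eq: "(norm t)\<^sup>2 = (\<Sum>j\<in>{1..p + s}. (cmod (cpx t j))\<^sup>2)"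
  using norm_vec_of[OF cpx(1), of t] by (simp add: cpx)

lemma vec_of_eqD:
  assumes "admissible f" "admissible g" "vec_of f = vec_of g" "j \<in> {1..p + s}"
  shows "f j = g j"
proof -
  have "vec_of (\<lambda>j. f j + of_real (-1) * g j) = 0"
    unfolding vec_of_add vec_of_scale using assms(3) by simp
  moreover have "admissible (\<lambda>j. f j + of_real (-1) * g j)"
    using assms by (auto simp: admissible_def)
  ultimately have "(\<Sum>j\<in>{1..p + s}. (cmod (f j + of_real (-1) * g j))\<^sup>2) = 0"
    using norm_vec_of by fastforce
  then have "(cmod (f j + of_real (-1) * g j))\<^sup>2 = 0"
    using assms(4) by (subst (asm) sum_nonneg_eq_0_iff) auto
  then show ?thesis by simp
qed

lemma cpx_vec_of: "admissible f \<Longrightarrow> j \<in> {1..p + s} \<Longrightarrow> cpx (vec_of f) j = f j"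
  by (rule vec_of_eqD) (auto simp: cpx)

lemma cpx_eqI: "(\<And>j. j \<in> {1..p + s} \<Longrightarrow> cpx t j = cpx u j) \<Longrightarrow> t = u"
proof -
  assume eq: "\<And>j. j \<in> {1..p + s} \<Longrightarrow> cpx t j = cpx u j"
  have "(norm (vec_of (\<lambda>j. cpx t j + of_real (-1) * cpx u j)))\<^sup>2 = 0"
    by (subst norm_vec_of) (use cpx(1) in \<open>auto simp: admissible_def eq\<close>)
  then show ?thesis unfolding vec_of_add vec_of_scale by (simp add: cpx)
qed

lemma admissible_cpx_add: "admissible f \<Longrightarrow> admissible g \<Longrightarrow> admissible (\<lambda>j. f j + g j)"
  by (auto simp: admissible_def)

lemma cpx_add: "j \<in> {1..p + s} \<Longrightarrow> cpx (t + u) j = cpx t j + cpx u j"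
  using cpx_vec_of[OF admissible_cpx_add[OF cpx(1) cpx(1)], of j t u]
  unfolding vec_of_add by (simp add: cpx)

lemma cpx_scale: "j \<in> {1..p + s} \<Longrightarrow> cpx (c *\<^sub>R t) j = of_real c * cpx t j"
proof -
  assume j: "j \<in> {1..p + s}"
  have "admissible (\<lambda>j. of_real c * cpx t j)" using cpx(1)[of t] by (auto simp: admissible_def)
  from cpx_vec_of[OF this j] show ?thesis unfolding vec_of_scale by (simp add: cpx)
qed

end

section \<open>Conjugates of a Pisot number\<close>

locale pisot_conjugates = tile_coords p s dim
  for p s :: nat and dim :: "'n::{finite,linorder} itself" +
  fixes \<beta> :: real and b :: "nat \<Rightarrow> complex"
  assumes pisot: "pisot \<beta>" and degree_min_poly: "degree (min_poly \<beta>) = Suc (p + 2 * s)"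
    and positive_degree: "p + 2 * s \<ge> 1"
    and enum: "conjugate_enumeration \<beta> p s b"
begin

lemma alg_int: "algebraic_int \<beta>" and beta_gt_1: "\<beta> > 1"
  using pisot by (auto simp: pisot_def)

lemma b_conj: "j \<in> {1..p + 2 * s} \<Longrightarrow> b j \<in> galois_conjugates \<beta>"
  using enum unfolding conjugate_enumeration_def bij_betw_def by blast

lemma b_norm: "j \<in> {1..p + 2 * s} \<Longrightarrow> cmod (b j) < 1"
  using pisot enum unfolding pisot_def conjugate_enumeration_def bij_betw_def by blast

lemma admissible_b: "admissible b"
  using enum by (auto simp: admissible_def conjugate_enumeration_def)

text \<open>Indices beyond \<open>p + s\<close> repeat earlier ones up to complex conjugation, so
  the coordinates of a real polynomial's values control its values at all conjugates.\<close>

lemma conjugates_cases: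
  assumes "z \<in> galois_conjugates \<beta>"
  obtains "z = of_real \<beta>" | j where "j \<in> {1..p + s}" "z = b j" | j where "j \<in> {1..p + s}" "z = cnj (b j)"
proof (cases "z = of_real \<beta>")
  case False
  with assms enum obtain j where j: "j \<in> {1..p + 2 * s}" "z = b j"
    unfolding conjugate_enumeration_def bij_betw_def by blast
  show ?thesis
  proof (cases "j \<le> p + s")
    case False
    with j have "j - (p + s) \<in> {1..s}" "j = p + s + (j - (p + s))" by auto
    with enum have "b (p + (j - (p + s))) = cnj (b j)"
      unfolding conjugate_enumeration_def by metis
    then have "z = cnj (b (p + (j - (p + s))))" by (simp add: j)
    moreover have "p + (j - (p + s)) \<in> {1..p + s}" using j False by auto
    ultimately show ?thesis using that(3) by blast
  qed (use j that in auto)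
qed

section \<open>The ring \<open>Z\<close> and multiplication by \<beta> in conjugate
  coordinates\<close>

definition Z :: "real set" where "Z = int_adjoin \<beta>"

lemma Z_iff: "x \<in> Z \<longleftrightarrow> (\<exists>q. x = int_eval q \<beta>)"
  by (auto simp: Z_def int_adjoin_def)

lemma int_eval_in: "int_eval q \<beta> \<in> Z"
  by (auto simp: Z_iff)

abbreviation \<Phi> :: "real \<Rightarrow> real ^ 'n::{finite,linorder}" where "\<Phi> \<equiv> Phi \<beta> p s b"

lemma coords_cong:
  assumes "\<And>j. j \<in> {1..p + s} \<Longrightarrow> f j = g j"
  shows "coords p s f = coords p s g"
proof -
  have "real_coords p s f = real_coords p s g"
    unfolding real_coords_def using assms
    by (intro arg_cong2[of _ _ _ _ "(@)"] arg_cong[of _ _ concat] map_cong) auto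
  then show ?thesis by (simp add: coords_def)
qed

lemma Phi_int_eval: "\<Phi> (int_eval q \<beta>) = vec_of (\<lambda>j. int_eval q (b j))"
  unfolding Phi_eq_coords by (rule coords_cong) (simp add: conj_iso_int_eval[OF alg_int b_conj])

lemma admissible_int_eval: "admissible (\<lambda>j. int_eval q (b j))"
proof -
  have "int_eval q z \<in> \<real>" if "z \<in> \<real>" for z :: complex
    using that by (elim Reals_cases) (simp add: int_eval_of_real)
  with admissible_b show ?thesis by (auto simp: admissible_def)
qed

lemma cpx_Phi: "x = int_eval q \<beta> \<Longrightarrow> j \<in> {1..p + s} \<Longrightarrow> cpx (\<Phi> x) j = int_eval q (b j)"
  by (simp only: Phi_int_eval cpx_vec_of[OF admissible_int_eval])

lemma Z_add: "x \<in> Z \<Longrightarrow> y \<in> Z \<Longrightarrow> x + y \<in> Z"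
  unfolding Z_iff by (metis int_eval_add)

lemma Z_mult: "x \<in> Z \<Longrightarrow> y \<in> Z \<Longrightarrow> x * y \<in> Z"
  unfolding Z_iff by (metis int_eval_mult)

lemma Z_of_int: "of_int k \<in> Z"
  unfolding Z_iff by (rule exI[of _ "[:k:]"]) (simp add: int_eval_pCons)

lemma Z_beta: "\<beta> \<in> Z"
  unfolding Z_iff by (rule exI[of _ "[:0, 1:]"]) (simp add: int_eval_pCons)

lemma Z_diff: "x \<in> Z \<Longrightarrow> y \<in> Z \<Longrightarrow> x - y \<in> Z"
  using Z_add[of x "of_int (-1) * y"] Z_mult[OF Z_of_int, of y "-1"] by simp

text \<open>Multiplication by \<beta> seen through the conjugates: a scaling at each real place, a
  rotation with scaling at each complex one.\<close>

definition M :: "real ^ 'n::{finite,linorder} \<Rightarrow> real ^ 'n::{finite,linorder}" where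
  "M t = vec_of (\<lambda>j. b j * cpx t j)"

lemma cpx_M: "j \<in> {1..p + s} \<Longrightarrow> cpx (M t) j = b j * cpx t j"
  unfolding M_def by (rule cpx_vec_of) (use admissible_b cpx(1) in \<open>auto simp: admissible_def\<close>)

text \<open>A conjugate 0 would make the minimal polynomial divide \<open>[:0, 1:]\<close>, although
  its degree is at least 2.\<close>

lemma b_nonzero: "j \<in> {1..p + 2 * s} \<Longrightarrow> b j \<noteq> 0"
proof
  assume "j \<in> {1..p + 2 * s}" "b j = 0"
  then have "rat_eval (min_poly \<beta>) (0 :: complex) = 0"
    using b_conj[of j] by (simp add: galois_conjugates_def)
  then have "min_poly \<beta> dvd [:0, 1:]"
    by (rule irreducible_dvd_of_common_root[OF min_poly(2)[OF alg_int]]) (simp add: rat_eval_pCons)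
  then have "degree (min_poly \<beta>) \<le> 1" using dvd_imp_degree_le[of "min_poly \<beta>" "[:0, 1:]"] by simp
  with degree_min_poly positive_degree show False by simp
qed

lemma linear_M: "linear M"
  by (intro linearI cpx_eqI) (simp_all add: cpx_M cpx_add cpx_scale algebra_simps)

lemma surj_M: "surj M"
proof (rule surjI)
  fix t
  have "admissible (\<lambda>j. cpx t j / b j)"
    using admissible_b cpx(1) by (auto simp: admissible_def)
  then show "M (vec_of (\<lambda>j. cpx t j / b j)) = t"
    using b_nonzero by (intro cpx_eqI) (auto simp: cpx_M cpx_vec_of)
qed

lemma Phi_beta: "x \<in> Z \<Longrightarrow> \<Phi> (\<beta> * x) = M (\<Phi> x)"
proof -
  assume "x \<in> Z"
  then obtain q where q: "x = int_eval q \<beta>" by (auto simp: Z_iff)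
  have "\<beta> * x = int_eval (pCons 0 q) \<beta>" by (simp add: q int_eval_pCons)
  from cpx_Phi[OF this] cpx_Phi[OF q] show ?thesis
    by (intro cpx_eqI) (simp add: cpx_M int_eval_pCons)
qed

lemma Phi_add: "x \<in> Z \<Longrightarrow> y \<in> Z \<Longrightarrow> \<Phi> (x + y) = \<Phi> x + \<Phi> y"
proof -
  assume "x \<in> Z" "y \<in> Z"
  then obtain q r where q: "x = int_eval q \<beta>" "y = int_eval r \<beta>" by (auto simp: Z_iff)
  then have "x + y = int_eval (q + r) \<beta>" by (simp add: int_eval_add)
  from cpx_Phi[OF this] cpx_Phi[OF q(1)] cpx_Phi[OF q(2)] show ?thesis
    by (intro cpx_eqI) (simp add: cpx_add int_eval_add)
qed

lemma Phi_of_int_mult: "x \<in> Z \<Longrightarrow> \<Phi> (of_int k * x) = of_int k *\<^sub>R \<Phi> x"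
proof -
  assume "x \<in> Z"
  then obtain q where q: "x = int_eval q \<beta>" by (auto simp: Z_iff)
  then have "of_int k * x = int_eval (smult k q) \<beta>" by (simp add: int_eval_smult)
  from cpx_Phi[OF this] cpx_Phi[OF q] show ?thesis
    by (intro cpx_eqI) (simp add: cpx_scale int_eval_smult)
qed

text \<open>\<open>M\<close> acts on each place separately, so the largest and smallest moduli of
  the \<open>b j\<close> bound it from both sides; \<open>c\<close> is the inverse of the
  smallest.\<close>

lemma contraction:
  obtains \<rho> c where "0 < \<rho>" "\<rho> < 1" "\<And>v. norm (M v) \<le> \<rho> * norm v" "c > 0"
    "\<And>v. norm v \<le> c * norm (M v)"
proof -
  let ?J = "{1..p + s}"
  have J: "?J \<noteq> {}" "finite ?J" using positive_degree by auto
  have b: "0 < cmod (b j)" "cmod (b j) < 1" if "j \<in> ?J" for j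
    using that b_nonzero[of j] b_norm[of j] by auto
  define \<rho> where "\<rho> = Max ((\<lambda>j. cmod (b j)) ` ?J)"
  define m where "m = Min ((\<lambda>j. cmod (b j)) ` ?J)"
  have "\<rho> \<in> (\<lambda>j. cmod (b j)) ` ?J" "m \<in> (\<lambda>j. cmod (b j)) ` ?J"
    unfolding \<rho>_def m_def using J by (auto intro!: Max_in Min_in)
  then have pos: "0 < \<rho>" "\<rho> < 1" "0 < m" using b by auto
  have le: "cmod (b j) \<le> \<rho>" "m \<le> cmod (b j)" if "j \<in> ?J" for j
    unfolding \<rho>_def m_def using that J by auto
  have normM: "(norm (M v))\<^sup>2 = (\<Sum>j\<in>?J. (cmod (b j))\<^sup>2 * (cmod (cpx v j))\<^sup>2)" for v
    unfolding norm_eq by (intro sum.cong) (auto simp: cpx_M norm_mult power_mult_distrib)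
  have "(norm (M v))\<^sup>2 \<le> (\<rho> * norm v)\<^sup>2" for v
    unfolding normM power_mult_distrib norm_eq[of v] sum_distrib_left
    using le(1) by (intro sum_mono mult_right_mono power_mono) auto
  then have 1: "norm (M v) \<le> \<rho> * norm v" for v
    using pos by (intro power2_le_imp_le[of "norm (M v)"]) auto
  have "(m * norm v)\<^sup>2 \<le> (norm (M v))\<^sup>2" for v
    unfolding normM power_mult_distrib norm_eq[of v] sum_distrib_left
    using le(2) pos by (intro sum_mono mult_right_mono power_mono) auto
  then have 2: "m * norm v \<le> norm (M v)" for v
    by (intro power2_le_imp_le[of "m * norm v"]) auto
  show ?thesis
    by (rule that[of \<rho> "1 / m"]) (use pos 1 2 in \<open>auto simp: field_simps\<close>)
qed

text \<open>Up to sign this is the norm of \<beta>: the product of \<beta> and its other conjugates,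
  which are nonzero, of modulus below 1 and at least one in number.\<close>

lemma constant_coeff_bound:
  assumes "min_poly \<beta> = map_poly of_int F"
  shows "0 < \<bar>coeff F 0\<bar>" "of_int \<bar>coeff F 0\<bar> < \<beta>"
proof -
  let ?G = "galois_conjugates \<beta>"
  have coeff: "rat_eval (min_poly \<beta>) (0 :: complex) = of_int (coeff F 0)"
    by (simp add: assms poly_0_coeff_0 coeff_map_poly)
  have enum': "bij_betw b {1..p + 2 * s} (?G - {of_real \<beta>})"
    using enum by (simp add: conjugate_enumeration_def)
  have "(\<Prod>z\<in>?G. cmod z) = \<beta> * (\<Prod>z\<in>?G - {of_real \<beta>}. cmod z)"
    using card_galois_conjugates(2)[OF alg_int] galois_conjugates_of_real[OF alg_int] beta_gt_1
    by (subst prod.remove[of _ "of_real \<beta>"]) auto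
  also have "(\<Prod>z\<in>?G - {of_real \<beta>}. cmod z) = (\<Prod>j\<in>{1..p + 2 * s}. cmod (b j))"
    by (rule prod.reindex_bij_betw[OF enum', symmetric])
  finally have prod: "of_int \<bar>coeff F 0\<bar> = \<beta> * (\<Prod>j\<in>{1..p + 2 * s}. cmod (b j))"
    using min_poly_at_0[OF alg_int] unfolding coeff by simp
  have "0 < \<beta> * (\<Prod>j\<in>{1..p + 2 * s}. cmod (b j))"
    using beta_gt_1 b_nonzero by (intro mult_pos_pos prod_pos) auto
  with prod show "0 < \<bar>coeff F 0\<bar>" by (metis of_int_0_less_iff)
  have "(\<Prod>j\<in>{1..p + 2 * s}. cmod (b j)) < (\<Prod>j\<in>{1..p + 2 * s}. 1 :: real)"
    using positive_degree b_norm by (intro prod_mono_strict) (auto simp: less_imp_le)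
  then have "\<beta> * (\<Prod>j\<in>{1..p + 2 * s}. cmod (b j)) < \<beta> * 1"
    using beta_gt_1 by (intro mult_strict_left_mono) auto
  with prod show "of_int \<bar>coeff F 0\<bar> < \<beta>" by simp
qed

text \<open>\<open>\<int>[\<beta>] / \<beta> \<int>[\<beta>]\<close> is represented by \<open>0, \<dots>, N - 1\<close>, where the norm \<open>N\<close> of \<open>\<beta>\<close>
  is smaller than \<open>\<beta>\<close>; so every point has a preimage whose first digit is less than \<open>N\<close>.\<close>

lemma beta_map_onto:
  assumes "x \<in> Z \<inter> {0..<1}"
  shows "\<exists>y\<in>Z \<inter> {0..<1}. beta_map \<beta> y = x"
proof -
  obtain F where F: "min_poly \<beta> = map_poly of_int F"
    using min_poly_integral[OF alg_int] by blast
  define N where "N = \<bar>coeff F 0\<bar>"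
  have N: "0 < N" "of_int N < \<beta>" using constant_coeff_bound[OF F] by (auto simp: N_def)
  obtain q where q: "x = int_eval q \<beta>" using assms by (auto simp: Z_iff)
  obtain a F' where aF: "F = pCons a F'" by (cases F)
  obtain c q' where cq: "q = pCons c q'" by (cases q)
  have "int_eval F \<beta> = 0"
    using min_poly(3)[OF alg_int] by (simp add: F rat_eval_of_int_poly)
  \<comment> \<open>The constant coefficient \<open>a\<close> of the minimal polynomial is a
    multiple of \<beta> in \<open>Z\<close>.\<close>
  then have a: "of_int a = - \<beta> * int_eval F' \<beta>" by (simp add: aF int_eval_pCons)
  \<comment> \<open>The first digit of the preimage, chosen so that \<open>a\<close> divides
    \<open>c + k\<close>; then \<open>x + of_int k\<close> is a multiple of \<beta> in
    \<open>Z\<close>.\<close>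
  define k where "k = (- c) mod N"
  have k: "0 \<le> k" "k \<le> N - 1" using N by (auto simp: k_def)
  have "a dvd c + k"
  proof -
    have "N dvd c + k" unfolding k_def by (metis add.commute diff_minus_eq_add dvd_minus_mod dvd_minus_iff minus_diff_eq)
    then show ?thesis by (simp add: N_def aF)
  qed
  then obtain m where m: "c + k = a * m" by (elim dvdE)
  have "of_int (c + k) = of_int a * of_int m" unfolding m by simp
  then have "x + of_int k = of_int a * of_int m + \<beta> * int_eval q' \<beta>"
    by (simp add: q cq int_eval_pCons)
  also have "\<dots> = \<beta> * (int_eval q' \<beta> - of_int m * int_eval F' \<beta>)"
    unfolding a by (simp add: algebra_simps)
  finally have xk: "x + of_int k = \<beta> * (int_eval q' \<beta> - of_int m * int_eval F' \<beta>)" .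
  define y where "y = int_eval q' \<beta> - of_int m * int_eval F' \<beta>"
  have y: "x + of_int k = \<beta> * y" using xk by (simp add: y_def)
  have "y \<in> Z" unfolding y_def by (intro Z_diff Z_mult Z_of_int int_eval_in)
  \<comment> \<open>From \<open>x < 1\<close> and \<open>k \<le> N - 1\<close> it follows that
    \<open>\<beta> * y = x + of_int k\<close> is below \<open>N\<close>, hence below
    \<beta>.\<close>
  moreover have "of_int k \<le> (of_int N - 1 :: real)" using k(2) by linarith
  then have "0 \<le> \<beta> * y" "\<beta> * y < \<beta> * 1" using assms k(1) N(2) unfolding y[symmetric] by auto
  then have "0 \<le> y" "y < 1" using beta_gt_1 by (auto simp: zero_le_mult_iff)
  moreover have "beta_map \<beta> y = x"
    using assms by (simp add: beta_map_def floor_eq_iff flip: y)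
  ultimately show ?thesis by auto
qed

text \<open>Powers of the fractional part of \<beta> become small; it is nonzero because \<beta>,
  having degree at least 2, is no integer.\<close>

lemma arbitrarily_small:
  assumes "\<epsilon> > 0"
  shows "\<exists>u\<in>Z. 0 < u \<and> u < \<epsilon>"
proof -
  define v where "v = \<beta> - of_int \<lfloor>\<beta>\<rfloor>"
  have "v \<noteq> 0"
  proof
    assume "v = 0"
    then have "rat_eval [:- of_int \<lfloor>\<beta>\<rfloor>, 1:] \<beta> = 0"
      by (simp add: v_def rat_eval_pCons of_rat_minus)
    then have "min_poly \<beta> dvd [:- of_int \<lfloor>\<beta>\<rfloor>, 1:]"
      by (rule irreducible_dvd_of_common_root[OF min_poly(2,3)[OF alg_int]])
    then have "degree (min_poly \<beta>) \<le> 1"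
      using dvd_imp_degree_le[of "min_poly \<beta>" "[:- of_int \<lfloor>\<beta>\<rfloor>, 1:]"] by simp
    with degree_min_poly positive_degree show False by simp
  qed
  then have v: "0 < v" "v < 1" unfolding v_def by linarith+
  have vZ: "v ^ n \<in> Z" for n
  proof (induction n)
    case (Suc n)
    have "v \<in> Z" unfolding v_def by (intro Z_diff Z_beta Z_of_int)
    with Suc show ?case by (simp add: Z_mult)
  qed (use Z_of_int[of 1] in simp)
  obtain n where "v ^ n < \<epsilon>" using real_arch_pow_inv[OF assms v(2)] by blast
  with v vZ show ?thesis by (intro bexI[of _ "v ^ n"]) auto
qed

section \<open>The lattice formed by \<open>Z\<close> and its conjugate coordinates\<close>

lemma small_degree_representative: "\<exists>r. degree r \<le> p + 2 * s \<and> int_eval r \<beta> = int_eval q \<beta>"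
proof -
  obtain F where F: "min_poly \<beta> = map_poly of_int F" "lead_coeff F = 1"
    using min_poly_integral[OF alg_int] by blast
  have F0: "int_eval F \<beta> = 0"
    using min_poly(3)[OF alg_int] by (simp add: F rat_eval_of_int_poly)
  have degF: "degree F = Suc (p + 2 * s)"
    using degree_min_poly by (simp add: F degree_map_poly)
  show ?thesis
  proof (induction q)
    case (pCons a q)
    then obtain r where r: "degree r \<le> p + 2 * s" "int_eval r \<beta> = int_eval q \<beta>" by blast
    \<comment> \<open>This coefficient of \<open>r\<close> moves to degree
      \<open>p + 2 * s + 1\<close> in \<open>pCons a r\<close>, where subtracting \<open>c\<close>
      times the monic \<open>F\<close> cancels it.\<close>
    define c where "c = coeff r (p + 2 * s)"
    define r' where "r' = pCons a r - smult c F"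
    have "int_eval r' \<beta> + int_eval (smult c F) \<beta> = int_eval (pCons a r) \<beta>"
      unfolding int_eval_add[symmetric] r'_def by simp
    then have "int_eval r' \<beta> = int_eval (pCons a q) \<beta>"
      by (simp add: int_eval_smult F0 int_eval_pCons r)
    moreover have "degree r' \<le> p + 2 * s"
    proof (rule degree_le, safe)
      fix i assume i: "p + 2 * s < i"
      show "coeff r' i = 0"
      proof (cases "i = Suc (p + 2 * s)")
        case True
        then show ?thesis using F(2) degF by (simp add: r'_def c_def)
      next
        case False
        with i obtain k where "i = Suc k" "p + 2 * s < k" by (cases i) auto
        then show ?thesis using r(1) degF by (simp add: r'_def coeff_eq_0)
      qed
    qed
    ultimately show ?case by blast
  qed (intro exI[of _ 0], simp)
qed

text \<open>\<open>ev z (a, v)\<close> is the value at \<open>z\<close> of the polynomial with coefficients \<open>a, v\<^sub>1, \<dots>, v\<^sub>d\<close>;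
  \<open>embedding\<close> carries the integer points of \<open>\<real> \<times> \<real>\<^sup>d\<close> onto the lattice \<open>{(x, \<Phi> x) | x \<in> \<int>[\<beta>]}\<close>.\<close>

definition ev :: "complex \<Rightarrow> real \<times> (real ^ 'n::{finite,linorder}) \<Rightarrow> complex" where
  "ev z w = of_real (fst w) + (\<Sum>i\<in>UNIV. of_real (snd w $ i) * z ^ Suc (rank i))"

definition embedding :: "real \<times> (real ^ 'n::{finite,linorder}) \<Rightarrow> real \<times> (real ^ 'n::{finite,linorder})" where
  "embedding w = (Re (ev (of_real \<beta>) w), vec_of (\<lambda>j. ev (b j) w))"

definition integral_points :: "(real \<times> (real ^ 'n::{finite,linorder})) set" where
  "integral_points = {w. fst w \<in> \<int> \<and> (\<forall>i. snd w $ i \<in> \<int>)}"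

lemma ev_add: "ev z (v + w) = ev z v + ev z w"
  by (simp add: ev_def algebra_simps sum.distrib)

lemma ev_scale: "ev z (c *\<^sub>R w) = of_real c * ev z w"
  by (simp add: ev_def algebra_simps sum_distrib_left)

lemma ev_cnj: "ev (cnj z) w = cnj (ev z w)"
  by (simp add: ev_def)

lemma ev_of_real: "ev (of_real x) w \<in> \<real>"
  by (simp add: ev_def)

lemma linear_embedding: "linear embedding"
proof (rule linearI)
  show "embedding (v + w) = embedding v + embedding w" for v w
    by (simp add: embedding_def ev_add vec_of_add)
  show "embedding (c *\<^sub>R w) = c *\<^sub>R embedding w" for c w
    by (simp add: embedding_def ev_scale vec_of_scale)
qed

lemma admissible_ev: "admissible (\<lambda>j. ev (b j) w)"
  unfolding admissible_def
proof
  fix j assume "j \<in> {1..p}"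
  with admissible_b have "b j \<in> \<real>" by (simp add: admissible_def)
  then show "ev (b j) w \<in> \<real>" by (elim Reals_cases) (simp only: ev_of_real)
qed

text \<open>A kernel element lists the coefficients of a polynomial of degree at most
  \<open>p + 2 * s\<close> that vanishes at all \<open>p + 2 * s + 1\<close> conjugates.\<close>

lemma inj_embedding: "inj embedding"
  unfolding linear_injective_0[OF linear_embedding]
proof (intro allI impI)
  fix w assume w0: "embedding w = 0"
  have ev\<beta>: "ev (of_real \<beta>) w = 0"
    using w0 ev_of_real[of \<beta> w] by (auto simp: embedding_def zero_prod_def complex_eq_iff complex_is_Real_iff)
  have evb: "ev (b j) w = 0" if "j \<in> {1..p + s}" for j
  proof -
    have "vec_of (\<lambda>j. ev (b j) w) = vec_of (\<lambda>j. of_real 0 * 0)"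
      unfolding vec_of_scale using w0 by (simp add: embedding_def zero_prod_def)
    from vec_of_eqD[OF admissible_ev _ this that] show ?thesis by (simp add: admissible_def)
  qed
  have root: "ev z w = 0" if "z \<in> galois_conjugates \<beta>" for z
    by (rule conjugates_cases[OF that]) (use ev\<beta> evb in \<open>auto simp: ev_cnj\<close>)
  define Q where "Q = pCons (complex_of_real (fst w)) (\<Sum>i\<in>UNIV. monom (of_real (snd w $ i)) (rank i))"
  have "poly Q z = ev z w" for z
    unfolding Q_def ev_def poly_pCons poly_sum poly_monom sum_distrib_left
    by (simp add: mult.left_commute)
  with root have sub: "galois_conjugates \<beta> \<subseteq> {z. poly Q z = 0}" by auto
  have "degree (\<Sum>i\<in>(UNIV :: 'n set). monom (complex_of_real (snd w $ i)) (rank i)) \<le> p + 2 * s - 1"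
  proof (rule degree_sum_le, simp)
    fix i :: 'n
    have "rank i \<le> p + 2 * s - 1" using rank_less[of i] by (simp add: CARD_dim)
    then show "degree (monom (complex_of_real (snd w $ i)) (rank i)) \<le> p + 2 * s - 1"
      using degree_monom_le order_trans by blast
  qed
  moreover have "degree Q \<le> Suc (degree (\<Sum>i\<in>(UNIV :: 'n set). monom (complex_of_real (snd w $ i)) (rank i)))"
    unfolding Q_def by (rule degree_pCons_le)
  ultimately have deg: "degree Q \<le> p + 2 * s" using positive_degree by linarith
  have Q0: "Q = 0"
  proof (rule ccontr)
    assume "Q \<noteq> 0"
    then have "card (galois_conjugates \<beta>) \<le> card {z. poly Q z = 0}" "card {z. poly Q z = 0} \<le> degree Q"
      using sub by (auto intro: card_mono poly_roots_finite card_poly_roots_bound)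
    with deg degree_min_poly card_galois_conjugates(1)[OF alg_int] show False by simp
  qed
  have "snd w $ i = 0" for i
  proof -
    have "coeff Q (Suc (rank i)) = of_real (snd w $ i)"
      by (simp add: Q_def coeff_sum rank_eq_iff)
    with Q0 show ?thesis by simp
  qed
  moreover have "fst w = 0" using Q0 by (simp add: Q_def)
  ultimately show "w = 0" by (simp add: prod_eq_iff vec_eq_iff)
qed

lemma integral_points_embedding:
  assumes "w \<in> integral_points"
  shows "\<exists>x\<in>Z. embedding w = (x, \<Phi> x)"
proof -
  define q where "q = pCons \<lfloor>fst w\<rfloor> (\<Sum>i\<in>UNIV. monom \<lfloor>snd w $ i\<rfloor> (rank i))"
  have fl: "of_int \<lfloor>fst w\<rfloor> = fst w" "of_int \<lfloor>snd w $ i\<rfloor> = snd w $ i" for i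
    using assms by (auto simp: integral_points_def)
  have flc: "of_int \<lfloor>fst w\<rfloor> = complex_of_real (fst w)"
    "of_int \<lfloor>snd w $ i\<rfloor> = complex_of_real (snd w $ i)" for i
    by (metis fl of_real_of_int_eq)+
  have q: "int_eval q z = ev z w" for z :: complex
    unfolding q_def ev_def int_eval_pCons int_eval_sum flc sum_distrib_left
    by (simp add: map_poly_monom poly_monom flc mult.left_commute)
  have "Re (ev (of_real \<beta>) w) = int_eval q \<beta>"
    unfolding q[symmetric] int_eval_of_real by simp
  then have "embedding w = (int_eval q \<beta>, \<Phi> (int_eval q \<beta>))"
    by (simp add: embedding_def Phi_int_eval q)
  then show ?thesis using int_eval_in by blast
qed

lemma Z_integral_point:
  assumes "x \<in> Z"
  shows "\<exists>w\<in>integral_points. embedding w = (x, \<Phi> x)"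
proof -
  \<comment> \<open>The degree bound lets all coefficients of \<open>q\<close> fit into
    \<open>w\<close>.\<close>
  obtain q where q: "degree q \<le> p + 2 * s" "x = int_eval q \<beta>"
    using assms small_degree_representative by (metis Z_iff)
  define w where "w = (real_of_int (coeff q 0), (\<chi> i :: 'n. real_of_int (coeff q (Suc (rank i)))))"
  have ev: "ev z w = int_eval q z" for z :: complex
  proof -
    have "int_eval q z = (\<Sum>k\<le>p + 2 * s. of_int (coeff q k) * z ^ k)"
    proof -
      have "int_eval q z = (\<Sum>k\<le>degree q. of_int (coeff q k) * z ^ k)"
        by (simp add: poly_altdef coeff_map_poly degree_map_poly)
      also have "\<dots> = (\<Sum>k\<le>p + 2 * s. of_int (coeff q k) * z ^ k)"
        by (rule sum.mono_neutral_left) (use q(1) in \<open>auto simp: coeff_eq_0\<close>)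
      finally show ?thesis .
    qed
    also have "\<dots> = of_int (coeff q 0) + (\<Sum>k<p + 2 * s. of_int (coeff q (Suc k)) * z ^ Suc k)"
      by (subst sum.atMost_shift) simp
    also have "(\<Sum>k<p + 2 * s. of_int (coeff q (Suc k)) * z ^ Suc k) =
        (\<Sum>i\<in>(UNIV :: 'n set). of_int (coeff q (Suc (rank i))) * z ^ Suc (rank i))"
      using sum.reindex_bij_betw[OF bij_betw_rank[where 'n = 'n],
          of "\<lambda>k. of_int (coeff q (Suc k)) * z ^ Suc k"]
      by (simp add: CARD_dim)
    finally show ?thesis by (simp add: ev_def w_def)
  qed
  have "embedding w = (x, \<Phi> x)"
    by (simp add: embedding_def ev Phi_int_eval q int_eval_of_real)
  moreover have "w \<in> integral_points" by (simp add: integral_points_def w_def)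
  ultimately show ?thesis by blast
qed

lemma finite_integral_points: "finite {w \<in> integral_points. norm w \<le> K}"
proof -
  define I where "I = {x :: real. x \<in> \<int> \<and> \<bar>x\<bar> \<le> K}"
  have "finite I" unfolding I_def by (rule finite_abs_int_segment)
  then have "finite (I \<times> (\<lambda>f. \<chi> i :: 'n. f i) ` (UNIV \<rightarrow>\<^sub>E I))"
    by (intro finite_cartesian_product finite_imageI finite_PiE) auto
  moreover have "{w \<in> integral_points. norm w \<le> K} \<subseteq> I \<times> (\<lambda>f. \<chi> i :: 'n. f i) ` (UNIV \<rightarrow>\<^sub>E I)"
  proof
    fix w assume "w \<in> {w \<in> integral_points. norm w \<le> K}"
    then have w: "w \<in> integral_points" "norm w \<le> K" by auto
    have "fst w \<in> I" using w norm_fst_le[of "fst w" "snd w"] by (auto simp: I_def integral_points_def)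
    moreover have "snd w $ i \<in> I" for i
      using w component_le_norm_cart[of "snd w" i] norm_snd_le[of "snd w" "fst w"]
      by (auto simp: I_def integral_points_def)
    then have "snd w \<in> (\<lambda>f. \<chi> i :: 'n. f i) ` (UNIV \<rightarrow>\<^sub>E I)"
      by (intro image_eqI[of _ _ "\<lambda>i. snd w $ i"]) auto
    ultimately show "w \<in> I \<times> (\<lambda>f. \<chi> i :: 'n. f i) ` (UNIV \<rightarrow>\<^sub>E I)"
      by (cases w) auto
  qed
  ultimately show ?thesis by (rule finite_subset[rotated])
qed

text \<open>An injective linear map is bounded below, so bounded lattice points come from bounded
  integral points.\<close>

lemma lattice_discrete: "finite {x \<in> Z. \<bar>x\<bar> \<le> C \<and> norm (\<Phi> x) \<le> C}"
proof -
  obtain B where B: "B > 0" "\<And>w. B * norm w \<le> norm (embedding w)"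
    using linear_inj_bounded_below_pos[OF linear_embedding inj_embedding] by metis
  have "{x \<in> Z. \<bar>x\<bar> \<le> C \<and> norm (\<Phi> x) \<le> C} \<subseteq>
      (\<lambda>w. fst (embedding w)) ` {w \<in> integral_points. norm w \<le> 2 * C / B}"
  proof
    fix x assume x: "x \<in> {x \<in> Z. \<bar>x\<bar> \<le> C \<and> norm (\<Phi> x) \<le> C}"
    then obtain w where w: "w \<in> integral_points" "embedding w = (x, \<Phi> x)"
      using Z_integral_point by blast
    have "B * norm w \<le> norm (x, \<Phi> x)" using B(2)[of w] w(2) by simp
    also have "\<dots> \<le> 2 * C" using norm_Pair_le[of x "\<Phi> x"] x by auto
    finally have "norm w \<le> 2 * C / B" using B(1) by (simp add: field_simps)
    with w show "x \<in> (\<lambda>w. fst (embedding w)) ` {w \<in> integral_points. norm w \<le> 2 * C / B}"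
      by (intro image_eqI[of _ _ w]) auto
  qed
  then show ?thesis by (rule finite_subset) (intro finite_imageI finite_integral_points)
qed

text \<open>The embedding is onto by dimension; rounding a preimage of \<open>(0, t)\<close> moves
  the image by a bounded amount. The 0 keeps \<open>x\<close> itself bounded.\<close>

lemma lattice_dense: "\<exists>R. \<forall>t. \<exists>x\<in>Z. \<bar>x\<bar> \<le> R \<and> norm (\<Phi> x - t) \<le> R"
proof -
  have surj: "surj embedding"
    by (rule linear_inj_imp_surj[OF linear_embedding inj_embedding])
  obtain B where B: "B > 0" "\<And>w. norm (embedding w) \<le> B * norm w"
    using linear_bounded_pos[OF linear_embedding] by blast
  define R where "R = B * (1 + real CARD('n))"
  have "\<exists>x\<in>Z. \<bar>x\<bar> \<le> R \<and> norm (\<Phi> x - t) \<le> R" for t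
  proof -
    obtain w where w: "embedding w = (0, t)" using surj by (metis surjD)
    define w' where "w' = (real_of_int \<lfloor>fst w\<rfloor>, (\<chi> i :: 'n. real_of_int \<lfloor>snd w $ i\<rfloor>))"
    have "w' \<in> integral_points" by (simp add: integral_points_def w'_def)
    then obtain x where x: "x \<in> Z" "embedding w' = (x, \<Phi> x)"
      using integral_points_embedding by blast
    have "norm (snd w' - snd w) \<le> (\<Sum>i\<in>UNIV. \<bar>(snd w' - snd w) $ i\<bar>)" by (rule norm_le_l1_cart)
    also have "\<dots> \<le> (\<Sum>i\<in>(UNIV :: 'n set). 1)"
      unfolding w'_def by (intro sum_mono) (simp, linarith)
    finally have "norm (snd w' - snd w) \<le> real CARD('n)" by simp
    moreover have "norm (fst w' - fst w) \<le> 1" unfolding w'_def by (simp, linarith)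
    ultimately have "norm (w' - w) \<le> 1 + real CARD('n)"
      using norm_Pair_le[of "fst w' - fst w" "snd w' - snd w"] by (simp add: minus_prod_def)
    then have "norm (embedding (w' - w)) \<le> R"
      using B(2)[of "w' - w"] B(1) mult_left_mono[of "norm (w' - w)" "1 + real CARD('n)" B]
      unfolding R_def by linarith
    then have "norm (x, \<Phi> x - t) \<le> R"
      using linear_diff[OF linear_embedding, of w' w] w x by simp
    then have "norm x \<le> R" "norm (\<Phi> x - t) \<le> R"
      using norm_fst_le[of x "\<Phi> x - t"] norm_snd_le[of "\<Phi> x - t" x] by auto
    with x show ?thesis by auto
  qed
  then show ?thesis by blast
qed

text \<open>Needed because (F) concerns \<open>int_adjoin (inverse \<beta>)\<close>. Dividing the
  monic equation of \<beta> by its top power writes 1 as \<open>inverse \<beta>\<close> times an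
  integer polynomial in \<open>inverse \<beta>\<close>; multiplying by \<beta> puts \<beta> into
  that ring.\<close>

lemma Z_subset_inverse: "Z \<subseteq> int_adjoin (inverse \<beta>)"
proof -
  let ?Y = "int_adjoin (inverse \<beta>)"
  have Y: "int_eval q (inverse \<beta>) \<in> ?Y" for q by (auto simp: int_adjoin_def)
  have add: "x + y \<in> ?Y" if "x \<in> ?Y" "y \<in> ?Y" for x y
    using that by (auto simp: int_adjoin_def simp flip: int_eval_add)
  have mult: "x * y \<in> ?Y" if "x \<in> ?Y" "y \<in> ?Y" for x y
    using that by (auto simp: int_adjoin_def simp flip: int_eval_mult)
  have int: "of_int k \<in> ?Y" for k using Y[of "[:k:]"] by (simp add: int_eval_pCons)
  obtain F where F: "min_poly \<beta> = map_poly of_int F" "lead_coeff F = 1"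
    using min_poly_integral[OF alg_int] by blast
  have F0: "int_eval F \<beta> = 0"
    using min_poly(3)[OF alg_int] by (simp add: F rat_eval_of_int_poly)
  have "reflect_poly (map_poly of_int F) = (map_poly of_int (reflect_poly F) :: real poly)"
    by (rule poly_eqI) (simp add: coeff_reflect_poly coeff_map_poly degree_map_poly)
  moreover have "poly (reflect_poly (map_poly of_int F)) (inverse \<beta>) = 0"
    using F0 beta_gt_1 poly_reflect_poly_nz[of "inverse \<beta>" "map_poly of_int F"] by simp
  ultimately have "int_eval (reflect_poly F) (inverse \<beta>) = 0" by simp
  moreover obtain a H where aH: "reflect_poly F = pCons a H" by (cases "reflect_poly F")
  moreover have "a = 1"
    using coeff_0_reflect_poly[of F] F(2) unfolding aH by simp
  ultimately have "1 + inverse \<beta> * int_eval H (inverse \<beta>) = 0" by (simp add: int_eval_pCons)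
  then have "\<beta> = of_int (-1) * int_eval H (inverse \<beta>)"
    using beta_gt_1 by (simp add: field_simps)
  then have b: "\<beta> \<in> ?Y" using mult[OF int Y] by metis
  have "int_eval q \<beta> \<in> ?Y" for q
    by (induction q) (use int[of 0] in \<open>auto simp: int_eval_pCons intro!: add mult int b\<close>)
  then show ?thesis by (auto simp: Z_iff)
qed

section \<open>Transfer to the integral beta-tiles\<close>

lemma tilings:
  shows "\<exists>m\<ge>1. weak_m_tiling m (int_adjoin \<beta> \<inter> {0..<1})
      (integral_beta_tile \<beta> p s b :: real \<Rightarrow> (real ^ 'n::{finite,linorder}) set)"
    and "finiteness_property \<beta> \<Longrightarrow> weak_tiling (int_adjoin \<beta> \<inter> {0..<1})
      (integral_beta_tile \<beta> p s b :: real \<Rightarrow> (real ^ 'n::{finite,linorder}) set)"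
proof -
  obtain \<rho> c where rho: "0 < \<rho>" "\<rho> < 1" "\<And>v. norm (M v) \<le> \<rho> * norm v" "c > 0"
    "\<And>v. norm v \<le> c * norm (M v)" using contraction by metis
  interpret L: beta_lattice \<beta> Z \<Phi> M \<rho> c
    by (rule beta_lattice.intro) (fact beta_gt_1 Z_of_int Z_add Z_mult Z_beta Phi_add Phi_of_int_mult Phi_beta
      linear_M surj_M rho lattice_discrete lattice_dense arbitrarily_small beta_map_onto)+
  have S: "integral_beta_tile \<beta> p s b = L.S"
    by (rule ext) (simp only: integral_beta_tile_def L.S_def flip: Z_def)
  show "\<exists>m\<ge>1. weak_m_tiling m (int_adjoin \<beta> \<inter> {0..<1})
      (integral_beta_tile \<beta> p s b :: real \<Rightarrow> (real ^ 'n::{finite,linorder}) set)"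
    unfolding S Z_def[symmetric] using L.weak_m_tiling_tiles L.covering_degree_ge_1 by blast
  assume "finiteness_property \<beta>"
  then have "\<exists>n. (beta_map \<beta> ^^ n) x = 0" if "x \<in> Z \<inter> {0..<1}" for x
    using that Z_subset_inverse unfolding finiteness_property_def by blast
  then show "weak_tiling (int_adjoin \<beta> \<inter> {0..<1})
      (integral_beta_tile \<beta> p s b :: real \<Rightarrow> (real ^ 'n::{finite,linorder}) set)"
    unfolding S Z_def[symmetric] by (rule L.weak_tiling_tiles)
qed

end

theorem theorem6p11:
  fixes \<beta> :: real and d p s :: nat and b :: "nat \<Rightarrow> complex"
  assumes "d \<ge> 1" and "CARD('n::{finite,linorder}) = d"
    and "pisot \<beta>" and "degree (min_poly \<beta>) = d + 1"
    and "conjugate_enumeration \<beta> p s b"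
  shows "(\<exists>m\<ge>1. weak_m_tiling m (int_adjoin \<beta> \<inter> {0..<1})
            (integral_beta_tile \<beta> p s b :: real \<Rightarrow> (real ^ 'n::{finite,linorder}) set)) \<and>
    (finiteness_property \<beta> \<longrightarrow>
       weak_tiling (int_adjoin \<beta> \<inter> {0..<1})
            (integral_beta_tile \<beta> p s b :: real \<Rightarrow> (real ^ 'n::{finite,linorder}) set))"
proof -
  have alg: "algebraic_int \<beta>" using assms(3) by (simp add: pisot_def)
  \<comment> \<open>Counting the conjugates other than \<beta> gives \<open>p + 2 * s = d\<close>,
    as the coordinate layout requires.\<close>
  have "card {1..p + 2 * s} = card (galois_conjugates \<beta> - {of_real \<beta>})"
    using assms(5) unfolding conjugate_enumeration_def by (blast intro: bij_betw_same_card)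
  also have "\<dots> = d"
    using card_galois_conjugates[OF alg] galois_conjugates_of_real[OF alg] assms(4) by simp
  finally have d: "p + 2 * s = d" by simp
  interpret pisot_conjugates p s "TYPE('n)" \<beta> b
    by unfold_locales (use assms d in auto)
  show ?thesis using tilings by blast
qed

end
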